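(* Let $\{P_\theta:\theta\in\Theta\}$, $\Theta\subset\mathbb{R}^d$ open, be a parametric family satisfying the regularity condition of order $2$ at $\theta\in\Theta$ (see context), and let $T$ be an unbiased estimator of $\theta$ with finite second moments and covariance matrix $\Sigma(\theta)$. Let $J(\theta)$ be the Fisher information matrix. Then, for every $v\in\mathbb{R}^d$, $$v^\top\big(\Sigma(\theta)-J(\theta)^{-1}\big)v=\|Z_v-\mathrm{Proj}_{\mathcal T_1}Z_v\|^2\ \ge\ \frac{\langle Z_v,\Pi_v\rangle^2}{\|\Pi_v\|^2},$$ where the right-hand side is taken to be $0$ if $\Pi_v=0$. Equivalently, in terms of components (with the same convention), $$v^\top(\Sigma-J^{-1})v\ \ge\ \frac{\Big(\sum_{p,i,j=1}^d v_p\,\widetilde v_i\widetilde v_j\,\langle\widetilde Z^{(p)},\Pi_{ij}\rangle\Big)^2}{\Big\|\sum_{i,j=1}^d\widetilde v_i\widetilde v_j\,\Pi_{ij}\Big\|^2}.$$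
   Context: Setting. $(\mathcal X,\mathcal F)$ is a measurable space with a $\sigma$-finite measure $\mu$; $\{P_\theta:\theta\in\Theta\}$, $\Theta\subset\mathbb{R}^d$ open, is a family of probability measures with strictly positive densities $f(x;\theta)=dP_\theta/d\mu$. $H=L^2(\mu)$ (real) with inner product $\langle u,w\rangle=\int uw\,d\mu$ and norm $\|\cdot\|$; $\mathrm{Proj}_V$ is orthogonal projection onto a closed subspace $V\subseteq H$. The square-root embedding is $s:\Theta\to H$, $s(\theta)(x)=\sqrt{f(x;\theta)}$. For a multi-index $\alpha\in\mathbb{N}_0^d$, $|\alpha|=\sum_i\alpha_i$, $\partial^\alpha=\partial_1^{\alpha_1}\cdots\partial_d^{\alpha_d}$ (derivatives in $\theta$), and $\eta_\alpha(\theta)=\partial^\alpha s(\theta)$; in particular $\eta_i=\partial_i s$. Regularity of order $m$ (at $\theta$): (i) $s:\Theta\to H$ is $m$-times Fréchet differentiable, so $\eta_\alpha(\theta)\in H$ for $1\le|\alpha|\le m$ and every $\theta\in\Theta$; (ii) the partial derivatives $\partial^\alpha f(x;\theta)$ exist for $|\alpha|\le m$, and for every real-valued statistic $T$ with $\mathbb{E}_\theta[T^2]<\infty$ (for all $\theta$) one has $\partial^\alpha\int T(x)f(x;\theta)\,d\mu=\int T(x)\,\partial^\alpha f(x;\theta)\,d\mu$ for all $|\alpha|\le m$; (iii) the Gram matrix $G^{(m)}(\theta)$ with entries $\langle\eta_\alpha,\eta_\beta\rangle$, $1\le|\alpha|,|\beta|\le m$, is strictly positive definite at $\theta$. Everything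 below is evaluated at the fixed $\theta$. $G=(\langle\eta_i,\eta_j\rangle)_{i,j=1}^d$; the Fisher information matrix is $J=4G$, i.e. $J_{ij}=4\langle\eta_i,\eta_j\rangle=\mathbb{E}_\theta[\partial_i\log f\,\partial_j\log f]$. $\mathcal T_1=\mathrm{span}\{\eta_1,\dots,\eta_d\}\subset H$. The second fundamental form has components $\Pi_{ij}=\partial_i\eta_j-\mathrm{Proj}_{\mathcal T_1}(\partial_i\eta_j)\in\mathcal T_1^\perp$. Estimator. $T=(T_1,\dots,T_d):\mathcal X\to\mathbb{R}^d$ is measurable with $\mathbb{E}_\theta[T_p^2]<\infty$ and $\mathbb{E}_\theta[T]=\theta$ for all $\theta\in\Theta$; $\Sigma(\theta)_{pq}=\mathbb{E}_\theta[(T_p-\theta_p)(T_q-\theta_q)]$. The lifted errors are $\widetilde Z^{(p)}=(T_p-\theta_p)\,s(\theta)\in H$. For $v\in\mathbb{R}^d$: $Z_v=\sum_{p}v_p\widetilde Z^{(p)}\in H$, $\widetilde v=G^{-1}v\in\mathbb{R}^d$, and $\Pi_v=\sum_{i,j=1}^d\widetilde v_i\widetilde v_j\Pi_{ij}\in\mathcal T_1^\perp$. *)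

theory Defs
  imports "HOL-Probability.Probability"
begin

section \<open>The space of square-integrable functions\<close>

text \<open>
  Elements of the Hilbert space are represented by square-integrable functions; two
  representatives denote the same element iff they agree almost everywhere, i.e. iff
  the norm of their difference is zero. Inner product and norm depend only on the class.
\<close>

definition L2_space :: "'a measure \<Rightarrow> ('a \<Rightarrow> real) set" where
  "L2_space \<mu> = {u \<in> borel_measurable \<mu>. integrable \<mu> (\<lambda>x. (u x)\<^sup>2)}"

definition L2_inner :: "'a measure \<Rightarrow> ('a \<Rightarrow> real) \<Rightarrow> ('a \<Rightarrow> real) \<Rightarrow> real" where
  "L2_inner \<mu> u w = (\<integral>x. u x * w x \<partial>\<mu>)"

definition L2_norm :: "'a measure \<Rightarrow> ('a \<Rightarrow> real) \<Rightarrow> real" where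
  "L2_norm \<mu> u = sqrt (L2_inner \<mu> u u)"

text \<open>The projection is determined up to almost-everywhere equality.\<close>

definition L2_proj :: "'a measure \<Rightarrow> ('a \<Rightarrow> real) set \<Rightarrow> ('a \<Rightarrow> real) \<Rightarrow> 'a \<Rightarrow> real" where
  "L2_proj \<mu> V u = (SOME w. w \<in> V \<and> (\<forall>y\<in>V. L2_inner \<mu> (\<lambda>x. u x - w x) y = 0))"


section \<open>Differentiation of maps into the square-integrable functions\<close>

text \<open>
  In \<open>L2_times_differentiable\<close> the function \<open>D hs \<theta>\<close> is the value of the \<open>k\<close>-th Frechet
  derivative at \<open>\<theta>\<close> on the directions \<open>hs = [h\<^sub>1, \<dots>, h\<^sub>k]\<close>, under the usual identification of
  iterated bounded linear maps with multilinear maps; the head of the list is the direction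
  of the last differentiation. The last clause is the Frechet condition in the multilinear
  operator norm. Boundedness is automatic because the parameter space is finite-dimensional.
\<close>

definition L2_times_differentiable ::
    "'a measure \<Rightarrow> nat \<Rightarrow> (real^'d) set \<Rightarrow> (real^'d \<Rightarrow> 'a \<Rightarrow> real) \<Rightarrow> bool" where
  "L2_times_differentiable \<mu> m \<Theta> F \<longleftrightarrow>
    (\<exists>D :: (real^'d) list \<Rightarrow> real^'d \<Rightarrow> 'a \<Rightarrow> real.
      (\<forall>\<theta>\<in>\<Theta>. D [] \<theta> = F \<theta>) \<and>
      (\<forall>\<theta>\<in>\<Theta>. \<forall>hs. length hs \<le> m \<longrightarrow> D hs \<theta> \<in> L2_space \<mu>) \<and>
      (\<forall>\<theta>\<in>\<Theta>. \<forall>hs ks u w a b. length hs + 1 + length ks \<le> m \<longrightarrow>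
        (AE x in \<mu>. D (hs @ (a *\<^sub>R u + b *\<^sub>R w) # ks) \<theta> x
                   = a * D (hs @ u # ks) \<theta> x + b * D (hs @ w # ks) \<theta> x)) \<and>
      (\<forall>k<m. \<forall>\<theta>\<in>\<Theta>. \<forall>\<epsilon>>0. \<exists>\<delta>>0. \<forall>h. norm h < \<delta> \<and> \<theta> + h \<in> \<Theta> \<longrightarrow>
        (\<forall>hs. length hs = k \<longrightarrow>
          L2_norm \<mu> (\<lambda>x. D hs (\<theta> + h) x - D hs \<theta> x - D (h # hs) \<theta> x)
            \<le> \<epsilon> * norm h * prod_list (map norm hs))))"

definition has_L2_partial ::
    "'a measure \<Rightarrow> 'd::finite \<Rightarrow> (real^'d \<Rightarrow> 'a \<Rightarrow> real) \<Rightarrow> ('a \<Rightarrow> real) \<Rightarrow> real^'d \<Rightarrow> bool" where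
  "has_L2_partial \<mu> i F g \<theta> \<longleftrightarrow>
    g \<in> L2_space \<mu> \<and> F \<theta> \<in> L2_space \<mu> \<and>
    (\<forall>\<^sub>F t in at 0. F (\<theta> + t *\<^sub>R axis i 1) \<in> L2_space \<mu>) \<and>
    ((\<lambda>t. L2_norm \<mu> (\<lambda>x. (F (\<theta> + t *\<^sub>R axis i 1) x - F \<theta> x) / t - g x)) \<longlongrightarrow> 0) (at 0)"

definition L2_partial ::
    "'a measure \<Rightarrow> 'd::finite \<Rightarrow> (real^'d \<Rightarrow> 'a \<Rightarrow> real) \<Rightarrow> real^'d \<Rightarrow> 'a \<Rightarrow> real" where
  "L2_partial \<mu> i F \<theta> = (SOME g. has_L2_partial \<mu> i F g \<theta>)"

primrec L2_partials ::
    "'a measure \<Rightarrow> 'd::finite list \<Rightarrow> (real^'d \<Rightarrow> 'a \<Rightarrow> real) \<Rightarrow> real^'d \<Rightarrow> 'a \<Rightarrow> real" where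
  "L2_partials \<mu> [] F = F"
| "L2_partials \<mu> (i # is) F = L2_partial \<mu> i (L2_partials \<mu> is F)"


section \<open>Partial derivatives of real functions and multi-indices\<close>

definition partial_deriv :: "'d::finite \<Rightarrow> (real^'d \<Rightarrow> real) \<Rightarrow> real^'d \<Rightarrow> real" where
  "partial_deriv i g \<theta> = deriv (\<lambda>t. g (\<theta> + t *\<^sub>R axis i 1)) 0"

primrec partial_derivs :: "'d::finite list \<Rightarrow> (real^'d \<Rightarrow> real) \<Rightarrow> real^'d \<Rightarrow> real" where
  "partial_derivs [] g = g"
| "partial_derivs (i # is) g = partial_deriv i (partial_derivs is g)"

primrec partials_exist :: "(real^'d) set \<Rightarrow> 'd::finite list \<Rightarrow> (real^'d \<Rightarrow> real) \<Rightarrow> bool" where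
  "partials_exist \<Theta> [] g \<longleftrightarrow> True"
| "partials_exist \<Theta> (i # is) g \<longleftrightarrow> partials_exist \<Theta> is g \<and>
    (\<forall>\<theta>\<in>\<Theta>. (\<lambda>t. partial_derivs is g (\<theta> + t *\<^sub>R axis i 1)) field_differentiable at 0)"

text \<open>
  A multi-index is a function \<open>\<alpha>\<close> on the (linearly ordered) coordinates. It is turned into the
  increasing list containing each coordinate \<open>i\<close> exactly \<open>\<alpha> i\<close> times, so that the derivative along
  this list is \<open>\<partial>\<^sub>1\<close> (taken \<open>\<alpha>\<^sub>1\<close> times) applied after \<open>\<partial>\<^sub>2\<close> (taken \<open>\<alpha>\<^sub>2\<close> times), and so on.
\<close>

definition mi_order :: "('d::finite \<Rightarrow> nat) \<Rightarrow> nat" where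
  "mi_order \<alpha> = (\<Sum>i\<in>UNIV. \<alpha> i)"

definition mi_list :: "('d::{finite,linorder} \<Rightarrow> nat) \<Rightarrow> 'd list" where
  "mi_list \<alpha> = concat (map (\<lambda>i. replicate (\<alpha> i) i) (sorted_list_of_set UNIV))"

definition pos_def_on :: "'i set \<Rightarrow> ('i \<Rightarrow> 'i \<Rightarrow> real) \<Rightarrow> bool" where
  "pos_def_on I A \<longleftrightarrow>
    (\<forall>c. (\<exists>\<alpha>\<in>I. c \<alpha> \<noteq> 0) \<longrightarrow> 0 < (\<Sum>\<alpha>\<in>I. \<Sum>\<beta>\<in>I. c \<alpha> * A \<alpha> \<beta> * c \<beta>))"

lemma finite_mi_order_le: "finite {\<alpha> :: 'd::finite \<Rightarrow> nat. 1 \<le> mi_order \<alpha> \<and> mi_order \<alpha> \<le> m}"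
proof (rule finite_subset)
  show "{\<alpha> :: 'd \<Rightarrow> nat. 1 \<le> mi_order \<alpha> \<and> mi_order \<alpha> \<le> m} \<subseteq> PiE UNIV (\<lambda>_. {..m})"
  proof safe
    fix \<alpha> :: "'d \<Rightarrow> nat" and i :: 'd
    assume "mi_order \<alpha> \<le> m"
    moreover have "\<alpha> i \<le> mi_order \<alpha>"
      unfolding mi_order_def by (rule member_le_sum) auto
    ultimately show "\<alpha> i \<le> m" by simp
  qed auto
  show "finite (PiE (UNIV :: 'd set) (\<lambda>_. {..m}))"
    by (rule finite_PiE) auto
qed


section \<open>The statistical model\<close>

definition density_family ::
    "'a measure \<Rightarrow> (real^'d) set \<Rightarrow> (real^'d \<Rightarrow> 'a measure) \<Rightarrow> ('a \<Rightarrow> real^'d \<Rightarrow> real) \<Rightarrow> bool" where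
  "density_family \<mu> \<Theta> P f \<longleftrightarrow>
    (\<forall>\<theta>\<in>\<Theta>. prob_space (P \<theta>) \<and>
      (\<lambda>x. f x \<theta>) \<in> borel_measurable \<mu> \<and> (\<forall>x\<in>space \<mu>. 0 < f x \<theta>) \<and>
      P \<theta> = density \<mu> (\<lambda>x. ennreal (f x \<theta>)))"

definition sqrt_embedding :: "('a \<Rightarrow> real^'d \<Rightarrow> real) \<Rightarrow> real^'d \<Rightarrow> 'a \<Rightarrow> real" where
  "sqrt_embedding f \<theta> = (\<lambda>x. sqrt (f x \<theta>))"

definition regular_order ::
    "'a measure \<Rightarrow> (real^('d::{finite,linorder})) set \<Rightarrow> (real^('d::{finite,linorder}) \<Rightarrow> 'a measure)
      \<Rightarrow> ('a \<Rightarrow> real^('d::{finite,linorder}) \<Rightarrow> real) \<Rightarrow> nat \<Rightarrow> real^('d::{finite,linorder}) \<Rightarrow> bool" where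
  "regular_order \<mu> \<Theta> P f m \<theta> \<longleftrightarrow>
    L2_times_differentiable \<mu> m \<Theta> (sqrt_embedding f) \<and>
    (\<forall>\<alpha>. mi_order \<alpha> \<le> m \<longrightarrow> (\<forall>x\<in>space \<mu>. partials_exist \<Theta> (mi_list \<alpha>) (f x))) \<and>
    (\<forall>S. S \<in> borel_measurable \<mu> \<and> (\<forall>\<theta>'\<in>\<Theta>. integrable (P \<theta>') (\<lambda>x. (S x)\<^sup>2)) \<longrightarrow>
      (\<forall>\<alpha>. mi_order \<alpha> \<le> m \<longrightarrow>
        partials_exist \<Theta> (mi_list \<alpha>) (\<lambda>\<theta>'. \<integral>x. S x * f x \<theta>' \<partial>\<mu>) \<and>
        (\<forall>\<theta>'\<in>\<Theta>. integrable \<mu> (\<lambda>x. S x * partial_derivs (mi_list \<alpha>) (f x) \<theta>') \<and>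
          partial_derivs (mi_list \<alpha>) (\<lambda>\<theta>''. \<integral>x. S x * f x \<theta>'' \<partial>\<mu>) \<theta>'
            = (\<integral>x. S x * partial_derivs (mi_list \<alpha>) (f x) \<theta>' \<partial>\<mu>)))) \<and>
    pos_def_on {\<alpha>. 1 \<le> mi_order \<alpha> \<and> mi_order \<alpha> \<le> m}
      (\<lambda>\<alpha> \<beta>. L2_inner \<mu> (L2_partials \<mu> (mi_list \<alpha>) (sqrt_embedding f) \<theta>)
                          (L2_partials \<mu> (mi_list \<beta>) (sqrt_embedding f) \<theta>))"

definition tangent_vec ::
    "'a measure \<Rightarrow> ('a \<Rightarrow> real^'d \<Rightarrow> real) \<Rightarrow> 'd::finite \<Rightarrow> real^'d \<Rightarrow> 'a \<Rightarrow> real" where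
  "tangent_vec \<mu> f i \<theta> = L2_partial \<mu> i (sqrt_embedding f) \<theta>"

definition tangent_space ::
    "'a measure \<Rightarrow> ('a \<Rightarrow> real^'d \<Rightarrow> real) \<Rightarrow> real^'d::finite \<Rightarrow> ('a \<Rightarrow> real) set" where
  "tangent_space \<mu> f \<theta> = {\<lambda>x. \<Sum>i\<in>UNIV. c i * tangent_vec \<mu> f i \<theta> x | c :: 'd \<Rightarrow> real. True}"

definition gram_matrix :: "'a measure \<Rightarrow> ('a \<Rightarrow> real^'d \<Rightarrow> real) \<Rightarrow> real^'d::finite \<Rightarrow> real^'d^'d" where
  "gram_matrix \<mu> f \<theta> = (\<chi> i j. L2_inner \<mu> (tangent_vec \<mu> f i \<theta>) (tangent_vec \<mu> f j \<theta>))"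

text \<open>
  The expected outer product of the score. Since \<open>\<partial>\<^sub>i s = \<partial>\<^sub>i f / (2 s)\<close> and \<open>f = s\<^sup>2\<close>, for a regular
  family it is four times \<open>gram_matrix\<close>.
\<close>

definition fisher_information ::
    "(real^'d \<Rightarrow> 'a measure) \<Rightarrow> ('a \<Rightarrow> real^'d \<Rightarrow> real) \<Rightarrow> real^'d::finite \<Rightarrow> real^'d^'d" where
  "fisher_information P f \<theta> = (\<chi> i j.
     \<integral>x. partial_deriv i (\<lambda>\<theta>'. ln (f x \<theta>')) \<theta> * partial_deriv j (\<lambda>\<theta>'. ln (f x \<theta>')) \<theta> \<partial>P \<theta>)"

definition second_fundamental_form ::
    "'a measure \<Rightarrow> ('a \<Rightarrow> real^'d \<Rightarrow> real) \<Rightarrow> 'd::finite \<Rightarrow> 'd \<Rightarrow> real^'d \<Rightarrow> 'a \<Rightarrow> real" where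
  "second_fundamental_form \<mu> f i j \<theta> = (\<lambda>x.
     L2_partial \<mu> i (tangent_vec \<mu> f j) \<theta> x
     - L2_proj \<mu> (tangent_space \<mu> f \<theta>) (L2_partial \<mu> i (tangent_vec \<mu> f j) \<theta>) x)"


section \<open>Estimators\<close>

definition unbiased_estimator ::
    "'a measure \<Rightarrow> (real^'d) set \<Rightarrow> (real^'d \<Rightarrow> 'a measure) \<Rightarrow> ('a \<Rightarrow> real^'d::finite) \<Rightarrow> bool" where
  "unbiased_estimator \<mu> \<Theta> P T \<longleftrightarrow>
    T \<in> borel_measurable \<mu> \<and>
    (\<forall>\<theta>\<in>\<Theta>. (\<forall>p. integrable (P \<theta>) (\<lambda>x. (T x $ p)\<^sup>2)) \<and> (\<integral>x. T x \<partial>P \<theta>) = \<theta>)"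

definition covariance_matrix ::
    "(real^'d \<Rightarrow> 'a measure) \<Rightarrow> ('a \<Rightarrow> real^'d::finite) \<Rightarrow> real^'d \<Rightarrow> real^'d^'d" where
  "covariance_matrix P T \<theta> = (\<chi> p q. \<integral>x. (T x $ p - \<theta> $ p) * (T x $ q - \<theta> $ q) \<partial>P \<theta>)"

text \<open>
  Dictionary: \<open>error_dir\<close> is \<open>Z\<^sub>v\<close>, the lifted error in direction \<open>v\<close>; \<open>raised\<close> is \<open>G\<close> inverse applied
  to \<open>v\<close>; \<open>second_form_dir\<close> is the second fundamental form on the diagonal at \<open>raised\<close>.
\<close>

definition lifted_error ::
    "('a \<Rightarrow> real^'d \<Rightarrow> real) \<Rightarrow> ('a \<Rightarrow> real^'d) \<Rightarrow> real^'d \<Rightarrow> 'd::finite \<Rightarrow> 'a \<Rightarrow> real" where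
  "lifted_error f T \<theta> p = (\<lambda>x. (T x $ p - \<theta> $ p) * sqrt_embedding f \<theta> x)"

definition error_dir ::
    "('a \<Rightarrow> real^'d \<Rightarrow> real) \<Rightarrow> ('a \<Rightarrow> real^'d) \<Rightarrow> real^'d \<Rightarrow> real^'d::finite \<Rightarrow> 'a \<Rightarrow> real" where
  "error_dir f T \<theta> v = (\<lambda>x. \<Sum>p\<in>UNIV. v $ p * lifted_error f T \<theta> p x)"

definition raised ::
    "'a measure \<Rightarrow> ('a \<Rightarrow> real^'d \<Rightarrow> real) \<Rightarrow> real^'d::finite \<Rightarrow> real^'d \<Rightarrow> real^'d" where
  "raised \<mu> f \<theta> v = matrix_inv (gram_matrix \<mu> f \<theta>) *v v"

definition second_form_dir ::
    "'a measure \<Rightarrow> ('a \<Rightarrow> real^'d \<Rightarrow> real) \<Rightarrow> real^'d \<Rightarrow> real^'d::finite \<Rightarrow> 'a \<Rightarrow> real" where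
  "second_form_dir \<mu> f \<theta> v = (\<lambda>x. \<Sum>i\<in>UNIV. \<Sum>j\<in>UNIV.
     raised \<mu> f \<theta> v $ i * raised \<mu> f \<theta> v $ j * second_fundamental_form \<mu> f i j \<theta> x)"

end

theory Submission
  imports Defs
begin

text \<open>
  Differentiating the unbiasedness identity under the integral gives
  \<open>\<langle>Z\<^sub>v, \<eta>\<^sub>j\<rangle> = v\<^sub>j / 2\<close>, because \<open>\<eta>\<^sub>j = \<partial>\<^sub>j f / (2 \<surd>f)\<close> almost everywhere: the difference
  quotients of \<open>\<surd>f\<close> converge pointwise, and a sequence of them converges almost everywhere to the
  \<open>L\<^sup>2\<close> derivative. The squared norm of the projection of \<open>Z\<^sub>v\<close> onto the tangent space is
  therefore \<open>v\<^sup>T G\<^sup>-\<^sup>1 v / 4 = v\<^sup>T J\<^sup>-\<^sup>1 v\<close>, which yields the equality by Pythagoras. Since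
  \<open>\<Pi>\<^sub>v\<close> is orthogonal to the tangent space, \<open>Z\<^sub>v\<close> may be replaced by its residual in
  \<open>\<langle>Z\<^sub>v, \<Pi>\<^sub>v\<rangle>\<close>, and the bound is the Cauchy-Schwarz inequality.
\<close>

section \<open>Inner products and projections\<close>

lemma L2_spaceD:
  assumes "u \<in> L2_space \<mu>"
  shows "u \<in> borel_measurable \<mu>" and "integrable \<mu> (\<lambda>x. (u x)\<^sup>2)"
  using assms by (auto simp: L2_space_def)

lemma L2_integrable_mult:
  assumes "u \<in> L2_space \<mu>" "w \<in> L2_space \<mu>"
  shows "integrable \<mu> (\<lambda>x. u x * w x)"
proof (rule Bochner_Integration.integrable_bound)
  show "integrable \<mu> (\<lambda>x. (u x)\<^sup>2 + (w x)\<^sup>2)"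
    using assms by (auto dest: L2_spaceD)
  show "(\<lambda>x. u x * w x) \<in> borel_measurable \<mu>"
    using assms by (intro borel_measurable_times L2_spaceD)
  have "\<bar>a * b\<bar> \<le> a\<^sup>2 + b\<^sup>2" for a b :: real
  proof -
    have "0 \<le> (\<bar>a\<bar> - \<bar>b\<bar>)\<^sup>2" by simp
    then have "2 * (\<bar>a\<bar> * \<bar>b\<bar>) \<le> a\<^sup>2 + b\<^sup>2" by (simp add: power2_diff)
    moreover have "0 \<le> \<bar>a\<bar> * \<bar>b\<bar>" by simp
    ultimately show ?thesis unfolding abs_mult by linarith
  qed
  then show "AE x in \<mu>. norm (u x * w x) \<le> norm ((u x)\<^sup>2 + (w x)\<^sup>2)" by simp
qed

lemma L2_space_add:
  assumes "u \<in> L2_space \<mu>" "w \<in> L2_space \<mu>"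
  shows "(\<lambda>x. u x + w x) \<in> L2_space \<mu>"
  using assms L2_integrable_mult[OF assms] unfolding L2_space_def
  by (auto simp: power2_sum mult.assoc)

lemma L2_space_cmult:
  assumes "u \<in> L2_space \<mu>"
  shows "(\<lambda>x. c * u x) \<in> L2_space \<mu>"
  using assms unfolding L2_space_def by (auto simp: power_mult_distrib)

lemma L2_space_diff:
  assumes "u \<in> L2_space \<mu>" "w \<in> L2_space \<mu>"
  shows "(\<lambda>x. u x - w x) \<in> L2_space \<mu>"
  using L2_space_add[OF assms(1) L2_space_cmult[OF assms(2), of "-1"]] by simp

lemma L2_space_sum:
  assumes "\<And>i. i \<in> I \<Longrightarrow> u i \<in> L2_space \<mu>"
  shows "(\<lambda>x. \<Sum>i\<in>I. u i x) \<in> L2_space \<mu>"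
  using assms
proof (induction I rule: infinite_finite_induct)
  case (insert i I)
  then show ?case by (simp add: L2_space_add)
qed (auto simp: L2_space_def)

lemma L2_space_divide:
  "u \<in> L2_space \<mu> \<Longrightarrow> (\<lambda>x. u x / c) \<in> L2_space \<mu>"
  using L2_space_cmult[of u \<mu> "inverse c"] by (simp add: field_simps)

lemma L2_inner_commute: "L2_inner \<mu> u w = L2_inner \<mu> w u"
  by (simp add: L2_inner_def mult.commute)

lemma L2_inner_cmult_left: "L2_inner \<mu> (\<lambda>x. c * u x) w = c * L2_inner \<mu> u w"
  by (simp add: L2_inner_def mult.assoc)

lemma L2_inner_cmult_right: "L2_inner \<mu> u (\<lambda>x. c * w x) = c * L2_inner \<mu> u w"
  by (simp add: L2_inner_def mult.left_commute)

lemma L2_inner_diff_left: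
  assumes "u \<in> L2_space \<mu>" "u' \<in> L2_space \<mu>" "w \<in> L2_space \<mu>"
  shows "L2_inner \<mu> (\<lambda>x. u x - u' x) w = L2_inner \<mu> u w - L2_inner \<mu> u' w"
  using assms by (simp add: L2_inner_def left_diff_distrib L2_integrable_mult)

lemma L2_inner_diff_right:
  assumes "u \<in> L2_space \<mu>" "w \<in> L2_space \<mu>" "w' \<in> L2_space \<mu>"
  shows "L2_inner \<mu> u (\<lambda>x. w x - w' x) = L2_inner \<mu> u w - L2_inner \<mu> u w'"
  using assms by (simp add: L2_inner_def right_diff_distrib L2_integrable_mult)

lemma L2_inner_sum_left:
  assumes "\<And>i. i \<in> I \<Longrightarrow> u i \<in> L2_space \<mu>" "w \<in> L2_space \<mu>"
  shows "L2_inner \<mu> (\<lambda>x. \<Sum>i\<in>I. u i x) w = (\<Sum>i\<in>I. L2_inner \<mu> (u i) w)"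
  using assms by (simp add: L2_inner_def sum_distrib_right L2_integrable_mult)

lemma L2_inner_sum_right:
  assumes "u \<in> L2_space \<mu>" "\<And>i. i \<in> I \<Longrightarrow> w i \<in> L2_space \<mu>"
  shows "L2_inner \<mu> u (\<lambda>x. \<Sum>i\<in>I. w i x) = (\<Sum>i\<in>I. L2_inner \<mu> u (w i))"
  using assms by (simp add: L2_inner_def sum_distrib_left L2_integrable_mult)

lemma L2_inner_self_nonneg: "0 \<le> L2_inner \<mu> u u"
  unfolding L2_inner_def by simp

lemma L2_norm_nonneg: "0 \<le> L2_norm \<mu> u"
  by (simp add: L2_norm_def L2_inner_self_nonneg)

lemma L2_norm_power2: "(L2_norm \<mu> u)\<^sup>2 = L2_inner \<mu> u u"
  by (simp add: L2_norm_def L2_inner_self_nonneg)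

text \<open>Vectors are functions here, not classes, while derivatives are determined only up to
  null sets. This licenses the exchange of representatives.\<close>

lemma L2_inner_cong_AE:
  assumes "AE x in \<mu>. u x = u' x" "AE x in \<mu>. w x = w' x"
    and "u \<in> borel_measurable \<mu>" "u' \<in> borel_measurable \<mu>"
    and "w \<in> borel_measurable \<mu>" "w' \<in> borel_measurable \<mu>"
  shows "L2_inner \<mu> u w = L2_inner \<mu> u' w'"
  unfolding L2_inner_def using assms by (intro integral_cong_AE) auto

lemma L2_norm_cong_AE:
  assumes "AE x in \<mu>. u x = u' x" "u \<in> borel_measurable \<mu>" "u' \<in> borel_measurable \<mu>"
  shows "L2_norm \<mu> u = L2_norm \<mu> u'"
  unfolding L2_norm_def using L2_inner_cong_AE[OF assms(1) assms(1)] assms by simp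

text \<open>If \<open>w\<close> vanishes almost everywhere, the quotient is \<open>0\<close> since \<open>x / 0 = 0\<close>.\<close>

lemma L2_Cauchy_Schwarz_quotient:
  assumes u: "u \<in> L2_space \<mu>" and w: "w \<in> L2_space \<mu>"
  shows "(L2_inner \<mu> u w)\<^sup>2 / (L2_norm \<mu> w)\<^sup>2 \<le> (L2_norm \<mu> u)\<^sup>2"
proof (cases "L2_inner \<mu> w w = 0")
  case True
  then show ?thesis by (simp add: L2_norm_power2 L2_inner_self_nonneg)
next
  case False
  \<comment> \<open>\<open>c * w\<close> is the best approximation of \<open>u\<close> by a multiple
    of \<open>w\<close>; nonnegativity of its squared error is the inequality.\<close>
  define c where "c = L2_inner \<mu> u w / L2_inner \<mu> w w"
  have cw: "(\<lambda>x. c * w x) \<in> L2_space \<mu>" by (rule L2_space_cmult[OF w])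
  have r: "(\<lambda>x. u x - c * w x) \<in> L2_space \<mu>" by (rule L2_space_diff[OF u cw])
  have "0 \<le> L2_inner \<mu> (\<lambda>x. u x - c * w x) (\<lambda>x. u x - c * w x)"
    by (rule L2_inner_self_nonneg)
  also have "\<dots> = L2_inner \<mu> u u - 2 * c * L2_inner \<mu> u w + c\<^sup>2 * L2_inner \<mu> w w"
    unfolding L2_inner_diff_left[OF u cw r] L2_inner_diff_right[OF u u cw]
      L2_inner_diff_right[OF w u cw] L2_inner_cmult_left L2_inner_cmult_right
      L2_inner_commute[of \<mu> w u]
    by (simp add: power2_eq_square algebra_simps)
  also have "\<dots> = L2_inner \<mu> u u - (L2_inner \<mu> u w)\<^sup>2 / L2_inner \<mu> w w"
    using False by (simp add: c_def field_simps power2_eq_square)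
  finally show ?thesis by (simp add: L2_norm_power2)
qed

lemma matrix_inv_left_right:
  fixes A :: "real^'n^'n"
  assumes "invertible A"
  shows "A ** matrix_inv A = mat 1" and "matrix_inv A ** A = mat 1"
  using someI_ex[OF assms[unfolded invertible_def]] unfolding matrix_inv_def by auto

text \<open>Serves to pass from \<open>J = 4 G\<close> to the inverses. Since
  \<open>matrix_inv\<close> picks some two-sided inverse, the formula is uniqueness of inverses:
  multiply the picked one by the explicit candidate and reassociate.\<close>

lemma matrix_inv_cmult:
  fixes A :: "real^'n^'n"
  assumes A: "invertible A" and c: "c \<noteq> 0"
  shows "matrix_inv (c *\<^sub>R A) = (1 / c) *\<^sub>R matrix_inv A"
proof -
  have 1: "(c *\<^sub>R A) ** ((1 / c) *\<^sub>R matrix_inv A) = mat 1"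
    and 2: "((1 / c) *\<^sub>R matrix_inv A) ** (c *\<^sub>R A) = mat 1"
    using c matrix_inv_left_right[OF A]
    by (simp_all add: matrix_scalar_ac scalar_matrix_assoc)
  then have "invertible (c *\<^sub>R A)" unfolding invertible_def by blast
  then have "matrix_inv (c *\<^sub>R A) ** (c *\<^sub>R A) = mat 1" by (rule matrix_inv_left_right)
  then have "matrix_inv (c *\<^sub>R A) ** (c *\<^sub>R A) ** ((1 / c) *\<^sub>R matrix_inv A)
      = (1 / c) *\<^sub>R matrix_inv A" by simp
  then show ?thesis unfolding matrix_mul_assoc[symmetric] 1 by simp
qed

text \<open>Normal equations: with \<open>b\<close> the vector of inner products of \<open>u\<close>
  with the \<open>\<eta> i\<close>, a combination of the \<open>\<eta> i\<close> leaves a residual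
  orthogonal to \<open>V\<close> exactly when \<open>G\<close> maps its coefficient vector to
  \<open>b\<close>. Invertibility of \<open>G\<close> yields a solution, so the choice in
  \<open>L2_proj\<close> has a witness, and forces the coefficients of whatever is chosen, so the
  residual can be computed.\<close>

lemma
  fixes \<mu> :: "'a measure" and \<eta> :: "'d::finite \<Rightarrow> 'a \<Rightarrow> real"
  defines "G \<equiv> (\<chi> i j. L2_inner \<mu> (\<eta> i) (\<eta> j)) :: real^'d^'d"
    and "V \<equiv> {\<lambda>x. \<Sum>i\<in>UNIV. c i * \<eta> i x | c :: 'd \<Rightarrow> real. True}"
  assumes \<eta>: "\<And>i. \<eta> i \<in> L2_space \<mu>" and G: "invertible G" and u: "u \<in> L2_space \<mu>"
  shows L2_proj_span_L2: "L2_proj \<mu> V u \<in> L2_space \<mu>"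
    and L2_proj_span_mem: "L2_proj \<mu> V u \<in> V"
    and L2_proj_span_orthogonal: "y \<in> V \<Longrightarrow> L2_inner \<mu> (\<lambda>x. u x - L2_proj \<mu> V u x) y = 0"
    and L2_proj_span_residual: "(L2_norm \<mu> (\<lambda>x. u x - L2_proj \<mu> V u x))\<^sup>2 = L2_inner \<mu> u u
          - (\<chi> i. L2_inner \<mu> u (\<eta> i)) \<bullet> (matrix_inv G *v (\<chi> i. L2_inner \<mu> u (\<eta> i)))"
proof -
  define b where "b = (\<chi> i. L2_inner \<mu> u (\<eta> i))"
  define lc where "lc c = (\<lambda>x. \<Sum>i\<in>UNIV. c i * \<eta> i x)" for c :: "'d \<Rightarrow> real"
  have V: "V = range lc" unfolding V_def lc_def by auto
  have lc_L2: "lc c \<in> L2_space \<mu>" for c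
    unfolding lc_def by (intro L2_space_sum L2_space_cmult \<eta>)
  have inner_lc: "L2_inner \<mu> w (lc c) = (\<Sum>i\<in>UNIV. c i * L2_inner \<mu> w (\<eta> i))"
    if "w \<in> L2_space \<mu>" for w c
    unfolding lc_def using that
    by (simp add: L2_inner_sum_right L2_space_cmult \<eta> L2_inner_cmult_right)
  have lc_\<eta>: "L2_inner \<mu> (lc c) (\<eta> i) = (G *v (\<chi> i. c i)) $ i" for c i
    unfolding L2_inner_commute[of \<mu> "lc c"] inner_lc[OF \<eta>]
    by (simp add: G_def matrix_vector_mult_def mult.commute)
  \<comment> \<open>Existence only: \<open>c0\<close> solves the normal equations and so witnesses
    the choice in \<open>L2_proj\<close>.\<close>
  define c0 where "c0 = matrix_inv G *v b"
  have "G *v c0 = b"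
    unfolding c0_def matrix_vector_mul_assoc matrix_inv_left_right[OF G] by simp
  then have "L2_inner \<mu> (\<lambda>x. u x - lc (($) c0) x) y = 0" if "y \<in> V" for y
    using that unfolding V
    by (auto simp: inner_lc L2_space_diff u lc_L2 L2_inner_diff_left \<eta> lc_\<eta> b_def)
  then have "\<exists>w. w \<in> V \<and> (\<forall>y\<in>V. L2_inner \<mu> (\<lambda>x. u x - w x) y = 0)"
    unfolding V by blast
  then have *: "L2_proj \<mu> V u \<in> V \<and> (\<forall>y\<in>V. L2_inner \<mu> (\<lambda>x. u x - L2_proj \<mu> V u x) y = 0)"
    unfolding L2_proj_def by (rule someI_ex)
  \<comment> \<open>The chosen projection comes with its own coefficients \<open>c\<close>; they are
    identified with \<open>matrix_inv G *v b\<close> further down.\<close>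
  then obtain c where c: "L2_proj \<mu> V u = lc c" unfolding V by blast
  show p: "L2_proj \<mu> V u \<in> L2_space \<mu>" unfolding c by (rule lc_L2)
  show "L2_proj \<mu> V u \<in> V" using * by blast
  show "y \<in> V \<Longrightarrow> L2_inner \<mu> (\<lambda>x. u x - L2_proj \<mu> V u x) y = 0" using * by blast
  have "\<eta> i \<in> V" for i
    unfolding V lc_def image_iff
    by (rule bexI[of _ "\<lambda>j. if j = i then 1 else 0"])
      (simp_all add: if_distrib[of "\<lambda>a. a * _"] cong: if_cong)
  then have "L2_inner \<mu> (\<lambda>x. u x - lc c x) (\<eta> i) = 0" for i
    using * unfolding c by blast
  then have "G *v (\<chi> i. c i) = b"
    by (simp add: vec_eq_iff b_def lc_\<eta>[symmetric] L2_inner_diff_left u lc_L2 \<eta>)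
  then have cb: "(\<chi> i. c i) = matrix_inv G *v b"
    using matrix_inv_left_right(2)[OF G] by (metis matrix_vector_mul_assoc matrix_vector_mul_lid)
  have r: "(\<lambda>x. u x - lc c x) \<in> L2_space \<mu>" by (intro L2_space_diff u lc_L2)
  \<comment> \<open>Pythagoras: the residual is orthogonal to the projection, so its squared norm is
    its inner product with \<open>u\<close> alone.\<close>
  have "lc c \<in> V" unfolding V by blast
  then have "L2_inner \<mu> (\<lambda>x. u x - lc c x) (lc c) = 0" using * unfolding c by blast
  then have "L2_inner \<mu> (\<lambda>x. u x - lc c x) (\<lambda>x. u x - lc c x)
      = L2_inner \<mu> u u - L2_inner \<mu> u (lc c)"
    by (simp add: L2_inner_diff_right[OF r u lc_L2] L2_inner_diff_left[OF u lc_L2 u]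
        L2_inner_commute[of \<mu> "lc c" u])
  also have "L2_inner \<mu> u (lc c) = b \<bullet> (\<chi> i. c i)"
    by (simp add: inner_lc u inner_vec_def b_def mult.commute)
  finally show "(L2_norm \<mu> (\<lambda>x. u x - L2_proj \<mu> V u x))\<^sup>2 = L2_inner \<mu> u u
          - (\<chi> i. L2_inner \<mu> u (\<eta> i)) \<bullet> (matrix_inv G *v (\<chi> i. L2_inner \<mu> u (\<eta> i)))"
    unfolding L2_norm_power2 c cb b_def .
qed


section \<open>Partial derivatives in the square-integrable functions\<close>

text \<open>\<open>nhds\<close> instead of \<open>at\<close> includes \<open>t = 0\<close>, as is
  wanted when the derivatives at \<open>0\<close> of two locally equal functions are
  identified.\<close>

lemma eventually_shift_in_open:
  fixes \<theta> :: "'b::real_normed_vector"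
  assumes "open \<Theta>" "\<theta> \<in> \<Theta>"
  shows "\<forall>\<^sub>F t :: real in nhds 0. \<theta> + t *\<^sub>R e \<in> \<Theta>"
proof -
  have "((\<lambda>t :: real. \<theta> + t *\<^sub>R e) \<longlongrightarrow> \<theta> + 0 *\<^sub>R e) (nhds 0)"
    by (intro tendsto_intros filterlim_ident)
  then show ?thesis using assms by (auto simp: tendsto_def)
qed

text \<open>Difference quotients that converge in \<open>L2_norm\<close> converge almost everywhere
  along a subsequence. Where the pointwise derivative exists, that subsequence also converges to it,
  and the two limits coincide.\<close>

lemma has_L2_partial_AE_eq:
  assumes F: "has_L2_partial \<mu> i F g \<theta>"
    and d: "AE x in \<mu>. ((\<lambda>t. F (\<theta> + t *\<^sub>R axis i 1) x) has_real_derivative g' x) (at 0)"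
  shows "AE x in \<mu>. g x = g' x"
proof -
  define q where "q t x = (F (\<theta> + t *\<^sub>R axis i 1) x - F \<theta> x) / t" for t x
  have g: "g \<in> L2_space \<mu>" and F0: "F \<theta> \<in> L2_space \<mu>"
    and ev: "\<forall>\<^sub>F t in at 0. F (\<theta> + t *\<^sub>R axis i 1) \<in> L2_space \<mu>"
    and lim: "((\<lambda>t. L2_norm \<mu> (\<lambda>x. q t x - g x)) \<longlongrightarrow> 0) (at 0)"
    using F unfolding has_L2_partial_def q_def by auto
  have inv0: "filterlim (\<lambda>n. 1 / real (Suc n)) (at 0) sequentially"
    unfolding filterlim_at using LIMSEQ_inverse_real_of_nat
    by (auto simp: inverse_eq_divide)
  obtain N where N: "\<And>n. N \<le> n \<Longrightarrow> F (\<theta> + (1 / real (Suc n)) *\<^sub>R axis i 1) \<in> L2_space \<mu>"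
    using filterlim_iff[THEN iffD1, OF inv0, rule_format, OF ev]
    unfolding eventually_sequentially by blast
  \<comment> \<open>The quotients are square-integrable only for small steps; shifting by
    \<open>N\<close> makes every term of the sequence so.\<close>
  define \<tau> where "\<tau> n = 1 / real (Suc (n + N))" for n
  have \<tau>: "filterlim \<tau> (at 0) sequentially"
    unfolding \<tau>_def by (rule filterlim_compose[OF inv0 filterlim_add_const_nat_at_top])
  have L2: "(\<lambda>x. q (\<tau> n) x - g x) \<in> L2_space \<mu>" for n
    unfolding q_def \<tau>_def by (intro L2_space_diff L2_space_divide N F0 g) simp
  have "(\<lambda>n. (L2_norm \<mu> (\<lambda>x. q (\<tau> n) x - g x))\<^sup>2) \<longlonglongrightarrow> 0\<^sup>2"
    by (intro tendsto_power filterlim_compose[OF lim \<tau>])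
  \<comment> \<open>Mean-square convergence is read as convergence to \<open>0\<close> of the
    integrals of the squares, the form from which an almost everywhere convergent subsequence is
    extracted.\<close>
  then have "(\<lambda>n. \<integral>x. norm ((q (\<tau> n) x - g x)\<^sup>2) \<partial>\<mu>) \<longlonglongrightarrow> 0"
    unfolding L2_norm_power2 L2_inner_def by (simp add: power2_eq_square[symmetric])
  then obtain r :: "nat \<Rightarrow> nat" where r: "strict_mono r"
    and ae: "AE x in \<mu>. (\<lambda>n. (q (\<tau> (r n)) x - g x)\<^sup>2) \<longlonglongrightarrow> 0"
    using tendsto_L1_AE_subseq[of \<mu> "\<lambda>n x. (q (\<tau> n) x - g x)\<^sup>2"] L2_spaceD(2)[OF L2] by blast
  have \<tau>r: "filterlim (\<lambda>n. \<tau> (r n)) (at 0) sequentially"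
    by (rule filterlim_compose[OF \<tau> filterlim_subseq[OF r]])
  show ?thesis using ae d
  proof eventually_elim
    case (elim x)
    have "(\<lambda>n. q (\<tau> (r n)) x - g x) \<longlonglongrightarrow> 0"
      using tendsto_real_sqrt[OF elim(1)] by (simp add: tendsto_rabs_zero_iff)
    then have 1: "(\<lambda>n. q (\<tau> (r n)) x) \<longlonglongrightarrow> g x" by (simp add: LIM_zero_iff)
    have "((\<lambda>t. q t x) \<longlongrightarrow> g' x) (at 0)"
      using DERIV_D[OF elim(2)] unfolding q_def by simp
    then have "(\<lambda>n. q (\<tau> (r n)) x) \<longlonglongrightarrow> g' x" using \<tau>r by (rule filterlim_compose)
    with 1 show ?case by (rule LIMSEQ_unique)
  qed
qed

text \<open>A difference quotient involves only two parameters, so the exceptional null set may vary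
  with the parameter: the union of two null sets is null. Openness keeps the shifted parameter in
  \<open>\<Theta>\<close>.\<close>

lemma has_L2_partial_cong_AE:
  assumes \<Theta>: "open \<Theta>" "\<theta> \<in> \<Theta>"
    and eq: "\<And>\<theta>'. \<theta>' \<in> \<Theta> \<Longrightarrow> AE x in \<mu>. F \<theta>' x = F' \<theta>' x"
    and L2: "\<And>\<theta>'. \<theta>' \<in> \<Theta> \<Longrightarrow> F' \<theta>' \<in> L2_space \<mu>"
    and F: "has_L2_partial \<mu> i F g \<theta>"
  shows "has_L2_partial \<mu> i F' g \<theta>"
proof -
  have near: "\<forall>\<^sub>F t in at 0. \<theta> + t *\<^sub>R axis i 1 \<in> \<Theta>"
    using eventually_shift_in_open[OF \<Theta>] by (simp add: eventually_nhds_conv_at)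
  have g: "g \<in> L2_space \<mu>" and F0: "F \<theta> \<in> L2_space \<mu>"
    and ev: "\<forall>\<^sub>F t in at 0. F (\<theta> + t *\<^sub>R axis i 1) \<in> L2_space \<mu>"
    and lim: "((\<lambda>t. L2_norm \<mu> (\<lambda>x. (F (\<theta> + t *\<^sub>R axis i 1) x - F \<theta> x) / t - g x)) \<longlongrightarrow> 0) (at 0)"
    using F unfolding has_L2_partial_def by auto
  have "\<forall>\<^sub>F t in at 0. L2_norm \<mu> (\<lambda>x. (F (\<theta> + t *\<^sub>R axis i 1) x - F \<theta> x) / t - g x)
      = L2_norm \<mu> (\<lambda>x. (F' (\<theta> + t *\<^sub>R axis i 1) x - F' \<theta> x) / t - g x)"
    using near ev
  proof eventually_elim
    case (elim t)
    have "AE x in \<mu>. (F (\<theta> + t *\<^sub>R axis i 1) x - F \<theta> x) / t - g x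
      = (F' (\<theta> + t *\<^sub>R axis i 1) x - F' \<theta> x) / t - g x"
      using eq[OF elim(1)] eq[OF \<Theta>(2)] by eventually_elim simp
    then show ?case
      by (rule L2_norm_cong_AE; intro L2_spaceD(1) L2_space_diff L2_space_divide g F0 L2 \<Theta>(2) elim)
  qed
  from Lim_transform_eventually[OF lim this] near show ?thesis
    unfolding has_L2_partial_def
    by (auto intro: g L2 \<Theta>(2) elim: eventually_mono)
qed

text \<open>The Frechet derivatives are evaluated on coordinate vectors. For an increment
  \<open>t *\<^sub>R e\<close> the remainder estimate, divided by the size of \<open>t\<close>, is
  the convergence of difference quotients. The whole family \<open>D\<close> is returned so that
  differentiation can be iterated.\<close>

lemma L2_times_differentiable_imp_has_L2_partial:
  fixes F :: "real^'d \<Rightarrow> 'a \<Rightarrow> real"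
  assumes F: "L2_times_differentiable \<mu> m \<Theta> F" and \<Theta>: "open \<Theta>"
  obtains D :: "'d list \<Rightarrow> real^'d \<Rightarrow> 'a \<Rightarrow> real"
    where "\<And>\<theta>. \<theta> \<in> \<Theta> \<Longrightarrow> D [] \<theta> = F \<theta>"
      and "\<And>\<theta> i js. \<theta> \<in> \<Theta> \<Longrightarrow> length js < m \<Longrightarrow> has_L2_partial \<mu> i (D js) (D (i # js) \<theta>) \<theta>"
proof -
  from F obtain D where D0: "\<forall>\<theta>\<in>\<Theta>. D [] \<theta> = F \<theta>"
    and L2_all: "\<forall>\<theta>\<in>\<Theta>. \<forall>hs. length hs \<le> m \<longrightarrow> D hs \<theta> \<in> L2_space \<mu>"
    and lin_all: "\<forall>\<theta>\<in>\<Theta>. \<forall>hs ks u w a b. length hs + 1 + length ks \<le> m \<longrightarrow>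
        (AE x in \<mu>. D (hs @ (a *\<^sub>R u + b *\<^sub>R w) # ks) \<theta> x
                   = a * D (hs @ u # ks) \<theta> x + b * D (hs @ w # ks) \<theta> x)"
    and lim: "\<forall>k<m. \<forall>\<theta>\<in>\<Theta>. \<forall>\<epsilon>>0. \<exists>\<delta>>0. \<forall>h. norm h < \<delta> \<and> \<theta> + h \<in> \<Theta> \<longrightarrow>
        (\<forall>hs. length hs = k \<longrightarrow>
          L2_norm \<mu> (\<lambda>x. D hs (\<theta> + h) x - D hs \<theta> x - D (h # hs) \<theta> x)
            \<le> \<epsilon> * norm h * prod_list (map norm hs))"
    unfolding L2_times_differentiable_def by (elim exE conjE) (rule that; assumption)
  have L2: "D hs \<theta> \<in> L2_space \<mu>" if "\<theta> \<in> \<Theta>" "length hs \<le> m" for hs \<theta>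
    using L2_all that by blast
  define ax where "ax js = map (\<lambda>j. axis j (1::real)) js" for js :: "'d list"
  \<comment> \<open>Unit vectors make the product of norms in the operator-norm estimate
    disappear.\<close>
  have prod_ax: "prod_list (map norm (ax js)) = 1" for js
    by (induction js) (simp_all add: ax_def)
  show thesis
  proof (rule that[of "\<lambda>js. D (ax js)"])
    show "D (ax []) \<theta> = F \<theta>" if "\<theta> \<in> \<Theta>" for \<theta>
      using D0 that by (simp add: ax_def)
    fix \<theta> i and js :: "'d list"
    assume \<theta>: "\<theta> \<in> \<Theta>" and len: "length js < m"
    define e :: "real^'d" where "e = axis i 1"
    have e1: "norm e = 1" by (simp add: e_def)
    have len': "length (ax js) < m" using len by (simp add: ax_def)
    have near: "\<forall>\<^sub>F t in at 0. \<theta> + t *\<^sub>R e \<in> \<Theta>"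
      using eventually_shift_in_open[OF \<Theta> \<theta>] by (simp add: eventually_nhds_conv_at)
    have g: "D (e # ax js) \<theta> \<in> L2_space \<mu>" and F0: "D (ax js) \<theta> \<in> L2_space \<mu>"
      using len' by (auto intro!: L2 \<theta>)
    have ev: "\<forall>\<^sub>F t in at 0. D (ax js) (\<theta> + t *\<^sub>R e) \<in> L2_space \<mu>"
      using near by eventually_elim (use len' in \<open>auto intro!: L2\<close>)
    have "\<forall>\<^sub>F t in at 0. dist (L2_norm \<mu> (\<lambda>x. (D (ax js) (\<theta> + t *\<^sub>R e) x - D (ax js) \<theta> x) / t
        - D (e # ax js) \<theta> x)) 0 < \<epsilon>" if "0 < \<epsilon>" for \<epsilon>
    proof -
      \<comment> \<open>Half of \<open>\<epsilon>\<close>, because the Frechet estimate is not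
        strict while convergence asks for a strict bound.\<close>
      obtain \<delta> where "0 < \<delta>" and \<delta>_all: "\<forall>h. norm h < \<delta> \<and> \<theta> + h \<in> \<Theta> \<longrightarrow>
          (\<forall>hs. length hs = length (ax js) \<longrightarrow>
            L2_norm \<mu> (\<lambda>x. D hs (\<theta> + h) x - D hs \<theta> x - D (h # hs) \<theta> x)
              \<le> \<epsilon> / 2 * norm h * prod_list (map norm hs))"
        using lim[rule_format, OF len' \<theta> half_gt_zero[OF \<open>0 < \<epsilon>\<close>]] by blast
      have \<delta>: "L2_norm \<mu> (\<lambda>x. D (ax js) (\<theta> + h) x - D (ax js) \<theta> x - D (h # ax js) \<theta> x)
            \<le> \<epsilon> / 2 * norm h" if "norm h < \<delta>" "\<theta> + h \<in> \<Theta>" for h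
        using \<delta>_all[rule_format, OF conjI[OF that] refl] unfolding prod_ax by simp
      have "\<forall>\<^sub>F t :: real in at 0. t \<noteq> 0 \<and> norm t < \<delta>"
        using \<open>0 < \<delta>\<close> by (auto simp: eventually_at dist_norm)
      then show ?thesis using near ev
      proof eventually_elim
        case (elim t)
        have te: "D (t *\<^sub>R e # ax js) \<theta> \<in> L2_space \<mu>" using len' by (auto intro!: L2 \<theta>)
        \<comment> \<open>Linearity in the head of the list, with second coefficient
          \<open>0\<close>, gives homogeneity; it holds up to a null set.\<close>
        have "AE x in \<mu>. D (t *\<^sub>R e # ax js) \<theta> x = t * D (e # ax js) \<theta> x"
          using lin_all[rule_format, OF \<theta>, of "[]" "ax js" t e 0 e] len' by simp
        then have "AE x in \<mu>. (D (ax js) (\<theta> + t *\<^sub>R e) x - D (ax js) \<theta> x) / t - D (e # ax js) \<theta> x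
            = inverse t * (D (ax js) (\<theta> + t *\<^sub>R e) x - D (ax js) \<theta> x - D (t *\<^sub>R e # ax js) \<theta> x)"
          by eventually_elim (use elim(1) in \<open>simp add: field_simps\<close>)
        then have "L2_norm \<mu> (\<lambda>x. (D (ax js) (\<theta> + t *\<^sub>R e) x - D (ax js) \<theta> x) / t
              - D (e # ax js) \<theta> x)
            = L2_norm \<mu> (\<lambda>x. inverse t
              * (D (ax js) (\<theta> + t *\<^sub>R e) x - D (ax js) \<theta> x - D (t *\<^sub>R e # ax js) \<theta> x))"
          by (rule L2_norm_cong_AE;
              intro L2_spaceD(1) L2_space_cmult L2_space_diff L2_space_divide g F0 te elim)
        also have "\<dots> = \<bar>inverse t\<bar>
            * L2_norm \<mu> (\<lambda>x. D (ax js) (\<theta> + t *\<^sub>R e) x - D (ax js) \<theta> x - D (t *\<^sub>R e # ax js) \<theta> x)"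
          by (simp add: L2_norm_def L2_inner_cmult_left L2_inner_cmult_right real_sqrt_mult
              mult.assoc[symmetric])
        also have "\<dots> \<le> \<bar>inverse t\<bar> * (\<epsilon> / 2 * norm (t *\<^sub>R e))"
          using elim e1 by (intro mult_left_mono \<delta>) auto
        also have "\<dots> = \<epsilon> / 2" using elim(1) e1 by simp
        also have "\<dots> < \<epsilon>" using \<open>0 < \<epsilon>\<close> by simp
        finally show ?case by (simp add: L2_norm_nonneg)
      qed
    qed
    then have "((\<lambda>t. L2_norm \<mu> (\<lambda>x. (D (ax js) (\<theta> + t *\<^sub>R e) x - D (ax js) \<theta> x) / t
        - D (e # ax js) \<theta> x)) \<longlongrightarrow> 0) (at 0)"
      unfolding tendsto_iff by blast
    then show "has_L2_partial \<mu> i (D (ax js)) (D (ax (i # js)) \<theta>) \<theta>"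
      using g F0 ev unfolding has_L2_partial_def by (simp add: ax_def e_def)
  qed
qed


section \<open>Tangent vectors, Fisher information and estimators of a regular model\<close>

text \<open>Extending a coefficient vector by zero outside the image of \<open>h\<close> leaves the
  quadratic form unchanged. This gives positive definiteness of principal submatrices.\<close>

lemma pos_def_on_reindex:
  assumes A: "pos_def_on I A" and I: "finite I" and h: "inj_on h J" "h ` J \<subseteq> I"
  shows "pos_def_on J (\<lambda>i j. A (h i) (h j))"
  unfolding pos_def_on_def
proof (intro allI impI)
  fix c :: "_ \<Rightarrow> real"
  assume c: "\<exists>i\<in>J. c i \<noteq> 0"
  define c' where "c' \<alpha> = (if \<alpha> \<in> h ` J then c (inv_into J h \<alpha>) else 0)" for \<alpha>
  have c'_h: "c' (h i) = c i" if "i \<in> J" for i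
    using that h by (simp add: c'_def)
  have "\<exists>\<alpha>\<in>I. c' \<alpha> \<noteq> 0"
    using c c'_h h(2) by force
  then have "0 < (\<Sum>\<alpha>\<in>I. \<Sum>\<beta>\<in>I. c' \<alpha> * A \<alpha> \<beta> * c' \<beta>)"
    using A unfolding pos_def_on_def by blast
  also have "\<dots> = (\<Sum>\<alpha>\<in>h ` J. \<Sum>\<beta>\<in>h ` J. c' \<alpha> * A \<alpha> \<beta> * c' \<beta>)"
  proof (rule sum.mono_neutral_cong_right[OF I h(2)])
    show "\<forall>\<alpha>\<in>I - h ` J. (\<Sum>\<beta>\<in>I. c' \<alpha> * A \<alpha> \<beta> * c' \<beta>) = 0"
      by (simp add: c'_def)
    show "(\<Sum>\<beta>\<in>I. c' \<alpha> * A \<alpha> \<beta> * c' \<beta>) = (\<Sum>\<beta>\<in>h ` J. c' \<alpha> * A \<alpha> \<beta> * c' \<beta>)" for \<alpha>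
      by (rule sum.mono_neutral_right[OF I h(2)]) (simp add: c'_def)
  qed
  also have "\<dots> = (\<Sum>i\<in>J. \<Sum>j\<in>J. c i * A (h i) (h j) * c j)"
    using h(1) by (simp add: sum.reindex c'_h)
  finally show "0 < (\<Sum>i\<in>J. \<Sum>j\<in>J. c i * A (h i) (h j) * c j)" .
qed

text \<open>A nonzero kernel vector would make the quadratic form vanish.\<close>

lemma pos_def_on_imp_invertible:
  fixes A :: "real^'n^'n"
  assumes "pos_def_on UNIV (\<lambda>i j. A $ i $ j)"
  shows "invertible A"
proof -
  have "x = 0" if "A *v x = 0" for x
  proof (rule ccontr)
    assume "x \<noteq> 0"
    then have "0 < (\<Sum>i\<in>UNIV. \<Sum>j\<in>UNIV. x $ i * A $ i $ j * x $ j)"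
      using assms unfolding pos_def_on_def by (auto simp: vec_eq_iff)
    also have "\<dots> = x \<bullet> (A *v x)"
      by (simp add: inner_vec_def matrix_vector_mult_def sum_distrib_left mult.assoc)
    finally show False using that by simp
  qed
  then show ?thesis unfolding invertible_left_inverse matrix_left_invertible_ker by blast
qed

text \<open>Indicators of single coordinates are the multi-indices of first derivatives; through
  them the regularity conditions specialise to one partial derivative.\<close>

lemma mi_list_unit: "mi_list (\<lambda>k. of_bool (k = i)) = [i]"
proof -
  have "concat (map (\<lambda>k. replicate (of_bool (k = i)) k) xs) = (if i \<in> set xs then [i] else [])"
    if "distinct xs" for xs :: "'a list"
    using that by (induction xs) auto
  then show ?thesis by (simp add: mi_list_def)
qed

lemma mi_order_unit: "mi_order (\<lambda>k. of_bool (k = i)) = 1"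
  by (simp add: mi_order_def)

text \<open>The differentiability and interchange conditions range over all of
  \<open>\<Theta>\<close>, but positive definiteness is given at \<open>\<theta>\<^sub>0\<close>
  alone. Hence the facts below concern an arbitrary \<open>\<theta>\<close> in
  \<open>\<Theta>\<close>, except invertibility of the Gram matrix.\<close>

context
  fixes \<mu> :: "'a measure" and \<Theta> :: "(real^('d::{finite,linorder})) set"
    and P :: "real^('d::{finite,linorder}) \<Rightarrow> 'a measure" and f :: "'a \<Rightarrow> real^('d::{finite,linorder}) \<Rightarrow> real"
    and m :: nat and \<theta>\<^sub>0 :: "real^('d::{finite,linorder})"
  assumes \<Theta>: "open \<Theta>" and family: "density_family \<mu> \<Theta> P f"
    and regular: "regular_order \<mu> \<Theta> P f m \<theta>\<^sub>0" and m: "1 \<le> m"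
begin

section \<open>Integration under the model\<close>

lemma density_pos: "\<theta> \<in> \<Theta> \<Longrightarrow> x \<in> space \<mu> \<Longrightarrow> 0 < f x \<theta>"
  using family by (simp add: density_family_def)

lemma density_measurable: "\<theta> \<in> \<Theta> \<Longrightarrow> (\<lambda>x. f x \<theta>) \<in> borel_measurable \<mu>"
  using family by (simp add: density_family_def)

lemma prob_space_model: "\<theta> \<in> \<Theta> \<Longrightarrow> prob_space (P \<theta>)"
  using family unfolding density_family_def by blast

lemma model_eq_density: "\<theta> \<in> \<Theta> \<Longrightarrow> P \<theta> = density \<mu> (\<lambda>x. ennreal (f x \<theta>))"
  using family unfolding density_family_def by blast

lemma space_model: "\<theta> \<in> \<Theta> \<Longrightarrow> space (P \<theta>) = space \<mu>"
  and sets_model: "\<theta> \<in> \<Theta> \<Longrightarrow> sets (P \<theta>) = sets \<mu>"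
  by (simp_all add: model_eq_density)

lemma
  assumes S: "S \<in> borel_measurable \<mu>" "\<And>\<theta>. \<theta> \<in> \<Theta> \<Longrightarrow> integrable (P \<theta>) (\<lambda>x. (S x)\<^sup>2)"
    and \<theta>: "\<theta> \<in> \<Theta>"
  shows integrable_partial: "integrable \<mu> (\<lambda>x. S x * partial_deriv i (f x) \<theta>)"
    and partial_integral: "partial_deriv i (\<lambda>\<theta>'. \<integral>x. S x * f x \<theta>' \<partial>\<mu>) \<theta>
      = (\<integral>x. S x * partial_deriv i (f x) \<theta> \<partial>\<mu>)"
proof -
  have "mi_order (\<lambda>k. of_bool (k = i)) \<le> m" using m by (simp add: mi_order_unit)
  moreover have "\<forall>S. S \<in> borel_measurable \<mu> \<and> (\<forall>\<theta>'\<in>\<Theta>. integrable (P \<theta>') (\<lambda>x. (S x)\<^sup>2)) \<longrightarrow>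
      (\<forall>\<alpha>. mi_order \<alpha> \<le> m \<longrightarrow>
        (\<forall>\<theta>'\<in>\<Theta>. integrable \<mu> (\<lambda>x. S x * partial_derivs (mi_list \<alpha>) (f x) \<theta>') \<and>
          partial_derivs (mi_list \<alpha>) (\<lambda>\<theta>''. \<integral>x. S x * f x \<theta>'' \<partial>\<mu>) \<theta>'
            = (\<integral>x. S x * partial_derivs (mi_list \<alpha>) (f x) \<theta>' \<partial>\<mu>)))"
    using regular unfolding regular_order_def by blast
  ultimately have "integrable \<mu> (\<lambda>x. S x * partial_derivs (mi_list (\<lambda>k. of_bool (k = i))) (f x) \<theta>) \<and>
      partial_derivs (mi_list (\<lambda>k. of_bool (k = i))) (\<lambda>\<theta>'. \<integral>x. S x * f x \<theta>' \<partial>\<mu>) \<theta>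
        = (\<integral>x. S x * partial_derivs (mi_list (\<lambda>k. of_bool (k = i))) (f x) \<theta> \<partial>\<mu>)"
    using S \<theta> by blast
  then show "integrable \<mu> (\<lambda>x. S x * partial_deriv i (f x) \<theta>)"
    and "partial_deriv i (\<lambda>\<theta>'. \<integral>x. S x * f x \<theta>' \<partial>\<mu>) \<theta>
      = (\<integral>x. S x * partial_deriv i (f x) \<theta> \<partial>\<mu>)"
    by (simp_all add: mi_list_unit)
qed

text \<open>The interchange condition applied to the constant statistic \<open>1\<close> asserts
  integrability of the partial derivative, hence its measurability.\<close>

lemma borel_measurable_partial:
  assumes "\<theta> \<in> \<Theta>"
  shows "(\<lambda>x. partial_deriv i (f x) \<theta>) \<in> borel_measurable \<mu>"
proof -
  have "integrable (P \<theta>') (\<lambda>_. 1 :: real)" if "\<theta>' \<in> \<Theta>" for \<theta>'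
    using prob_space.finite_measure[OF prob_space_model[OF that]]
    by (rule finite_measure.integrable_const)
  then have "integrable \<mu> (\<lambda>x. 1 * partial_deriv i (f x) \<theta>)"
    by (intro integrable_partial assms) simp_all
  then show ?thesis by simp
qed

lemma integral_model:
  fixes u :: "'a \<Rightarrow> real"
  assumes "\<theta> \<in> \<Theta>" and u: "u \<in> borel_measurable \<mu>"
  shows "(\<integral>x. u x \<partial>P \<theta>) = (\<integral>x. u x * f x \<theta> \<partial>\<mu>)"
proof -
  have "AE x in \<mu>. 0 \<le> f x \<theta>"
    using density_pos[OF assms(1)] by (auto intro: less_imp_le)
  then show ?thesis
    using integral_density[OF u density_measurable[OF assms(1)]]
    by (simp add: model_eq_density[OF assms(1)] mult.commute)
qed

lemma integrable_model:
  fixes u :: "'a \<Rightarrow> real"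
  assumes "\<theta> \<in> \<Theta>" and u: "u \<in> borel_measurable \<mu>"
  shows "integrable (P \<theta>) u \<longleftrightarrow> integrable \<mu> (\<lambda>x. u x * f x \<theta>)"
proof -
  have "AE x in \<mu>. 0 \<le> f x \<theta>"
    using density_pos[OF assms(1)] by (auto intro: less_imp_le)
  then show ?thesis
    using integrable_density[OF u density_measurable[OF assms(1)]]
    by (simp add: model_eq_density[OF assms(1)] mult.commute)
qed

section \<open>Derivatives of the density and of its square root\<close>

lemma density_has_partial:
  assumes "\<theta> \<in> \<Theta>" "x \<in> space \<mu>"
  shows "((\<lambda>t. f x (\<theta> + t *\<^sub>R axis i 1)) has_real_derivative partial_deriv i (f x) \<theta>) (at 0)"
proof -
  have "partials_exist \<Theta> (mi_list (\<lambda>k. of_bool (k = i))) (f x)"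
    using regular m assms(2) mi_order_unit[of i] unfolding regular_order_def by simp
  then show ?thesis
    using assms(1) by (simp add: mi_list_unit partial_deriv_def DERIV_deriv_iff_field_differentiable)
qed

text \<open>Positivity of the density allows the chain rule for the square root at every point; the
  mean-square derivative must agree with this pointwise one. In particular any two mean-square
  partial derivatives of the embedding agree almost everywhere.\<close>

lemma sqrt_embedding_partial_AE:
  assumes \<theta>: "\<theta> \<in> \<Theta>" and g: "has_L2_partial \<mu> i (sqrt_embedding f) g \<theta>"
  shows "AE x in \<mu>. g x = partial_deriv i (f x) \<theta> / (2 * sqrt (f x \<theta>))"
proof (rule has_L2_partial_AE_eq[OF g], rule AE_I2)
  fix x assume x: "x \<in> space \<mu>"
  show "((\<lambda>t. sqrt_embedding f (\<theta> + t *\<^sub>R axis i 1) x) has_real_derivative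
      partial_deriv i (f x) \<theta> / (2 * sqrt (f x \<theta>))) (at 0)"
    unfolding sqrt_embedding_def using density_pos[OF \<theta> x]
    by (auto intro!: derivative_eq_intros density_has_partial[OF \<theta> x] simp: field_simps)
qed

text \<open>\<open>D []\<close> is known to be the embedding only on \<open>\<Theta>\<close>, so the
  first derivative is carried over to \<open>sqrt_embedding f\<close> itself by the congruence
  rule.\<close>

lemma sqrt_embedding_derivatives:
  obtains D where "\<And>\<theta> i. \<theta> \<in> \<Theta> \<Longrightarrow> has_L2_partial \<mu> i (sqrt_embedding f) (D [i] \<theta>) \<theta>"
    and "\<And>\<theta> i js. \<theta> \<in> \<Theta> \<Longrightarrow> length js < m \<Longrightarrow> has_L2_partial \<mu> i (D js) (D (i # js) \<theta>) \<theta>"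
proof -
  have "L2_times_differentiable \<mu> m \<Theta> (sqrt_embedding f)"
    using regular unfolding regular_order_def by blast
  then obtain D
    where D0: "\<And>\<theta>. \<theta> \<in> \<Theta> \<Longrightarrow> D [] \<theta> = sqrt_embedding f \<theta>"
      and D: "\<And>\<theta> i js. \<theta> \<in> \<Theta> \<Longrightarrow> length js < m \<Longrightarrow> has_L2_partial \<mu> i (D js) (D (i # js) \<theta>) \<theta>"
    using \<Theta> by (rule L2_times_differentiable_imp_has_L2_partial) blast
  have first: "has_L2_partial \<mu> i (D []) (D [i] \<theta>) \<theta>" if "\<theta> \<in> \<Theta>" for \<theta> i
    using D[OF that, of "[]" i] m by simp
  have "has_L2_partial \<mu> i (sqrt_embedding f) (D [i] \<theta>) \<theta>" if "\<theta> \<in> \<Theta>" for \<theta> i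
  proof (rule has_L2_partial_cong_AE[OF \<Theta> that _ _ first[OF that]])
    fix \<theta>' assume "\<theta>' \<in> \<Theta>"
    then show "AE x in \<mu>. D [] \<theta>' x = sqrt_embedding f \<theta>' x"
      and "sqrt_embedding f \<theta>' \<in> L2_space \<mu>"
      using first[of \<theta>'] unfolding has_L2_partial_def by (simp_all add: D0)
  qed
  then show thesis using D by (rule that)
qed

text \<open>Some derivative exists, so the one selected in \<open>L2_partial\<close> is a
  derivative.\<close>

lemma tangent_vec_partial:
  assumes "\<theta> \<in> \<Theta>"
  shows "has_L2_partial \<mu> i (sqrt_embedding f) (tangent_vec \<mu> f i \<theta>) \<theta>"
proof -
  obtain D where "has_L2_partial \<mu> i (sqrt_embedding f) (D [i] \<theta>) \<theta>"
    by (rule sqrt_embedding_derivatives) (use assms in blast)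
  then show ?thesis
    unfolding tangent_vec_def L2_partial_def by (rule someI[of "\<lambda>g. has_L2_partial \<mu> i _ g \<theta>"])
qed

lemma tangent_vec_L2: "\<theta> \<in> \<Theta> \<Longrightarrow> tangent_vec \<mu> f i \<theta> \<in> L2_space \<mu>"
  using tangent_vec_partial unfolding has_L2_partial_def by blast

lemma sqrt_embedding_L2: "\<theta> \<in> \<Theta> \<Longrightarrow> sqrt_embedding f \<theta> \<in> L2_space \<mu>"
  using tangent_vec_partial unfolding has_L2_partial_def by blast

text \<open>\<open>tangent_vec\<close> selects a representative separately at each parameter, so it
  need not equal the Frechet family \<open>D [j]\<close>. Both agree almost everywhere with the
  pointwise formula, and the derivative of \<open>D [j]\<close> is therefore one of
  \<open>tangent_vec\<close> as well.\<close>

lemma second_partial_L2: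
  assumes "\<theta> \<in> \<Theta>" and "2 \<le> m"
  shows "L2_partial \<mu> i (tangent_vec \<mu> f j) \<theta> \<in> L2_space \<mu>"
proof -
  obtain D
    where D1: "\<And>\<theta> i. \<theta> \<in> \<Theta> \<Longrightarrow> has_L2_partial \<mu> i (sqrt_embedding f) (D [i] \<theta>) \<theta>"
    and D: "\<And>\<theta> i js. \<theta> \<in> \<Theta> \<Longrightarrow> length js < m \<Longrightarrow> has_L2_partial \<mu> i (D js) (D (i # js) \<theta>) \<theta>"
    by (rule sqrt_embedding_derivatives) blast
  have eq: "AE x in \<mu>. D [j] \<theta>' x = tangent_vec \<mu> f j \<theta>' x" if \<theta>': "\<theta>' \<in> \<Theta>" for \<theta>'
    using sqrt_embedding_partial_AE[OF \<theta>' D1[OF \<theta>'], of j]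
      sqrt_embedding_partial_AE[OF \<theta>' tangent_vec_partial[OF \<theta>'], of j]
    by eventually_elim simp
  have "has_L2_partial \<mu> i (D [j]) (D [i, j] \<theta>) \<theta>"
    using assms by (intro D) simp_all
  with eq tangent_vec_L2 have "has_L2_partial \<mu> i (tangent_vec \<mu> f j) (D [i, j] \<theta>) \<theta>"
    by (rule has_L2_partial_cong_AE[OF \<Theta> assms(1)])
  then have "has_L2_partial \<mu> i (tangent_vec \<mu> f j) (L2_partial \<mu> i (tangent_vec \<mu> f j) \<theta>) \<theta>"
    unfolding L2_partial_def by (rule someI[of "\<lambda>g. has_L2_partial \<mu> i _ g \<theta>"])
  then show ?thesis unfolding has_L2_partial_def by blast
qed

section \<open>Fisher information and inner products of the lifted errors\<close>

lemma tangent_vec_AE: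
  assumes "\<theta> \<in> \<Theta>"
  shows "AE x in \<mu>. tangent_vec \<mu> f i \<theta> x = partial_deriv i (f x) \<theta> / (2 * sqrt (f x \<theta>))"
  by (rule sqrt_embedding_partial_AE[OF assms tangent_vec_partial[OF assms]])

text \<open>\<open>gram_matrix\<close> is the principal submatrix of first-order multi-indices in
  the positive definite Gram matrix of order \<open>m\<close>.\<close>

lemma invertible_gram_matrix: "invertible (gram_matrix \<mu> f \<theta>\<^sub>0)"
proof (rule pos_def_on_imp_invertible)
  let ?I = "{\<alpha> :: 'd \<Rightarrow> nat. 1 \<le> mi_order \<alpha> \<and> mi_order \<alpha> \<le> m}"
  let ?h = "\<lambda>i k. of_bool (k = i) :: nat"
  have "inj ?h" by (rule injI, drule fun_cong) (auto simp: of_bool_def split: if_splits)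
  moreover have "range ?h \<subseteq> ?I" using m by (auto simp: mi_order_unit)
  moreover have "pos_def_on ?I (\<lambda>\<alpha> \<beta>.
      L2_inner \<mu> (L2_partials \<mu> (mi_list \<alpha>) (sqrt_embedding f) \<theta>\<^sub>0)
        (L2_partials \<mu> (mi_list \<beta>) (sqrt_embedding f) \<theta>\<^sub>0))"
    using regular unfolding regular_order_def by blast
  ultimately have "pos_def_on UNIV (\<lambda>i j.
      L2_inner \<mu> (L2_partials \<mu> (mi_list (?h i)) (sqrt_embedding f) \<theta>\<^sub>0)
        (L2_partials \<mu> (mi_list (?h j)) (sqrt_embedding f) \<theta>\<^sub>0))"
    using pos_def_on_reindex[OF _ finite_mi_order_le] by blast
  then show "pos_def_on UNIV (\<lambda>i j. gram_matrix \<mu> f \<theta>\<^sub>0 $ i $ j)"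
    by (simp add: mi_list_unit gram_matrix_def tangent_vec_def)
qed

text \<open>The score is \<open>\<partial>\<^sub>i f / f\<close> and the tangent vector
  \<open>\<partial>\<^sub>i f / (2 \<surd>f)\<close>, so a product of two scores times
  \<open>f\<close> is four times the product of the tangent vectors.\<close>

lemma fisher_information_eq_gram_matrix:
  assumes \<theta>: "\<theta> \<in> \<Theta>"
  shows "fisher_information P f \<theta> = 4 *\<^sub>R gram_matrix \<mu> f \<theta>"
proof -
  have ln: "partial_deriv i (\<lambda>\<theta>'. ln (f x \<theta>')) \<theta> = partial_deriv i (f x) \<theta> / f x \<theta>"
    if "x \<in> space \<mu>" for i x
    unfolding partial_deriv_def[of i "\<lambda>\<theta>'. ln (f x \<theta>')"]
    using density_pos[OF \<theta> that]
    by (intro DERIV_imp_deriv) (auto intro!: derivative_eq_intros density_has_partial[OF \<theta> that])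
  note [measurable] = borel_measurable_partial[OF \<theta>] density_measurable[OF \<theta>]
    L2_spaceD(1)[OF tangent_vec_L2[OF \<theta>]]
  have "(\<integral>x. partial_deriv i (\<lambda>\<theta>'. ln (f x \<theta>')) \<theta> * partial_deriv j (\<lambda>\<theta>'. ln (f x \<theta>')) \<theta> \<partial>P \<theta>)
    = 4 * L2_inner \<mu> (tangent_vec \<mu> f i \<theta>) (tangent_vec \<mu> f j \<theta>)" for i j
  proof -
    have "(\<integral>x. partial_deriv i (\<lambda>\<theta>'. ln (f x \<theta>')) \<theta> * partial_deriv j (\<lambda>\<theta>'. ln (f x \<theta>')) \<theta> \<partial>P \<theta>)
      = (\<integral>x. (partial_deriv i (f x) \<theta> / f x \<theta>) * (partial_deriv j (f x) \<theta> / f x \<theta>) \<partial>P \<theta>)"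
      using space_model[OF \<theta>] by (intro Bochner_Integration.integral_cong) (simp_all add: ln)
    also have "\<dots> = (\<integral>x. (partial_deriv i (f x) \<theta> / f x \<theta>)
        * (partial_deriv j (f x) \<theta> / f x \<theta>) * f x \<theta> \<partial>\<mu>)"
      by (rule integral_model[OF \<theta>]) measurable
    also have "\<dots> = (\<integral>x. 4 * (tangent_vec \<mu> f i \<theta> x * tangent_vec \<mu> f j \<theta> x) \<partial>\<mu>)"
    proof (rule integral_cong_AE)
      show "AE x in \<mu>. (partial_deriv i (f x) \<theta> / f x \<theta>)
          * (partial_deriv j (f x) \<theta> / f x \<theta>) * f x \<theta>
        = 4 * (tangent_vec \<mu> f i \<theta> x * tangent_vec \<mu> f j \<theta> x)"
        using tangent_vec_AE[OF \<theta>, of i] tangent_vec_AE[OF \<theta>, of j] AE_space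
      proof eventually_elim
        case (elim x)
        have "sqrt (f x \<theta>) * sqrt (f x \<theta>) = f x \<theta>" "0 < f x \<theta>"
          using density_pos[OF \<theta> elim(3)] by simp_all
        then show ?case unfolding elim(1,2) by (simp add: field_simps)
      qed
    qed measurable
    finally show ?thesis by (simp add: L2_inner_def)
  qed
  then show ?thesis by (simp add: fisher_information_def gram_matrix_def vec_eq_iff)
qed

text \<open>The centre \<open>a\<close> is independent of \<open>\<theta>\<close>: when unbiasedness
  is differentiated, the centre stays frozen at the base point while the parameter of the density
  moves.\<close>

lemma
  assumes T: "unbiased_estimator \<mu> \<Theta> P T" and \<theta>: "\<theta> \<in> \<Theta>"
  shows estimator_error_measurable: "(\<lambda>x. T x $ p - a) \<in> borel_measurable \<mu>"
    and estimator_error_square_integrable: "integrable (P \<theta>) (\<lambda>x. (T x $ p - a)\<^sup>2)"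
    and estimator_bias: "(\<integral>x. (T x $ p - a) * f x \<theta> \<partial>\<mu>) = \<theta> $ p - a"
proof -
  interpret prob_space "P \<theta>" by (rule prob_space_model[OF \<theta>])
  have T_borel: "T \<in> borel_measurable \<mu>" using T by (simp add: unbiased_estimator_def)
  have T_comp [measurable]: "(\<lambda>x. T x $ q) \<in> borel_measurable \<mu>" for q
    using borel_measurable_inner[OF T_borel, of "\<lambda>_. axis q 1"] by (simp add: inner_axis)
  show borel: "(\<lambda>x. T x $ p - a) \<in> borel_measurable \<mu>" by measurable
  have sq: "integrable (P \<theta>) (\<lambda>x. (T x $ q)\<^sup>2)" for q
    using T \<theta> by (simp add: unbiased_estimator_def)
  have int: "integrable (P \<theta>) (\<lambda>x. T x $ q)" for q
    by (rule square_integrable_imp_integrable[OF _ sq])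
      (use T_comp[of q] measurable_cong_sets[OF sets_model[OF \<theta>] refl] in blast)
  have "integrable (P \<theta>) (\<lambda>x. (T x $ p)\<^sup>2 - 2 * a * T x $ p + a\<^sup>2)"
    by (intro Bochner_Integration.integrable_add Bochner_Integration.integrable_diff sq
        integrable_mult_right int integrable_const)
  then show "integrable (P \<theta>) (\<lambda>x. (T x $ p - a)\<^sup>2)"
    by (simp add: power2_diff algebra_simps)
  \<comment> \<open>Unbiasedness is an equation between vector-valued integrals. To take components,
    \<open>T\<close> itself must be integrable, so it is reassembled from its coordinates.\<close>
  have "integrable (P \<theta>) (\<lambda>x. \<Sum>q\<in>UNIV. T x $ q *\<^sub>R axis q (1::real))"
    by (intro Bochner_Integration.integrable_sum integrable_scaleR_left int)
  also have "(\<lambda>x. \<Sum>q\<in>UNIV. T x $ q *\<^sub>R axis q 1) = T"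
    by (simp add: fun_eq_iff vec_eq_iff axis_def if_distrib[of "\<lambda>a. _ * a"] cong: if_cong)
  finally have "integrable (P \<theta>) T" .
  then have "(\<integral>x. T x \<bullet> axis p 1 \<partial>P \<theta>) = (\<integral>x. T x \<partial>P \<theta>) \<bullet> axis p 1"
    by (intro integral_inner_left)
  then have "(\<integral>x. T x $ p - a \<partial>P \<theta>) = \<theta> $ p - a"
    using T \<theta> int[of p] by (simp add: unbiased_estimator_def inner_axis prob_space)
  then show "(\<integral>x. (T x $ p - a) * f x \<theta> \<partial>\<mu>) = \<theta> $ p - a"
    by (simp add: integral_model[OF \<theta> borel])
qed

lemma lifted_error_L2:
  assumes T: "unbiased_estimator \<mu> \<Theta> P T" and \<theta>: "\<theta> \<in> \<Theta>"
  shows "lifted_error f T \<theta> p \<in> L2_space \<mu>"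
proof -
  note [measurable] = estimator_error_measurable[OF T \<theta>] L2_spaceD(1)[OF sqrt_embedding_L2[OF \<theta>]]
  have "integrable \<mu> (\<lambda>x. (T x $ p - \<theta> $ p)\<^sup>2 * f x \<theta>)"
    using estimator_error_square_integrable[OF T \<theta>, of p "\<theta> $ p"]
    by (subst (asm) integrable_model[OF \<theta>]) measurable
  also have "?this \<longleftrightarrow> integrable \<mu> (\<lambda>x. (lifted_error f T \<theta> p x)\<^sup>2)"
    by (intro Bochner_Integration.integrable_cong)
      (auto simp: lifted_error_def sqrt_embedding_def power_mult_distrib less_imp_le density_pos[OF \<theta>])
  finally show ?thesis
    unfolding L2_space_def lifted_error_def by simp
qed

text \<open>The square roots cancel in the product, leaving half the integral of the error against
  \<open>\<partial>\<^sub>j f\<close>; that integral is the derivative of the bias with frozen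
  centre, a Kronecker delta.\<close>

lemma lifted_error_inner_tangent_vec:
  assumes T: "unbiased_estimator \<mu> \<Theta> P T" and \<theta>: "\<theta> \<in> \<Theta>"
  shows "L2_inner \<mu> (lifted_error f T \<theta> p) (tangent_vec \<mu> f j \<theta>) = (if p = j then 1 / 2 else 0)"
proof -
  note [measurable] = estimator_error_measurable[OF T \<theta>] L2_spaceD(1)[OF sqrt_embedding_L2[OF \<theta>]]
    L2_spaceD(1)[OF tangent_vec_L2[OF \<theta>]] borel_measurable_partial[OF \<theta>]
    L2_spaceD(1)[OF lifted_error_L2[OF T \<theta>]]
  \<comment> \<open>At the shifted parameter the mean error about the old centre is exactly the
    shift in coordinate \<open>p\<close>.\<close>
  have "\<forall>\<^sub>F t in nhds 0. (\<integral>x. (T x $ p - \<theta> $ p) * f x (\<theta> + t *\<^sub>R axis j 1) \<partial>\<mu>)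
      = t * (if p = j then 1 else 0)"
    using eventually_shift_in_open[OF \<Theta> \<theta>, of "axis j 1"]
    by eventually_elim (simp only: estimator_bias[OF T], simp add: axis_def)
  then have "partial_deriv j (\<lambda>\<theta>'. \<integral>x. (T x $ p - \<theta> $ p) * f x \<theta>' \<partial>\<mu>) \<theta>
      = deriv (\<lambda>t. t * (if p = j then 1 else 0)) 0"
    unfolding partial_deriv_def by (rule deriv_cong_ev) simp
  also have "\<dots> = (if p = j then 1 else 0)"
    by (rule DERIV_imp_deriv) (auto intro!: derivative_eq_intros)
  finally have "(\<integral>x. (T x $ p - \<theta> $ p) * partial_deriv j (f x) \<theta> \<partial>\<mu>) = (if p = j then 1 else 0)"
    using partial_integral[OF estimator_error_measurable[OF T \<theta>]
        estimator_error_square_integrable[OF T] \<theta>] by simp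
  moreover have "L2_inner \<mu> (lifted_error f T \<theta> p) (tangent_vec \<mu> f j \<theta>)
      = (\<integral>x. 1 / 2 * ((T x $ p - \<theta> $ p) * partial_deriv j (f x) \<theta>) \<partial>\<mu>)"
    unfolding L2_inner_def
  proof (rule integral_cong_AE)
    show "AE x in \<mu>. lifted_error f T \<theta> p x * tangent_vec \<mu> f j \<theta> x
        = 1 / 2 * ((T x $ p - \<theta> $ p) * partial_deriv j (f x) \<theta>)"
      using tangent_vec_AE[OF \<theta>, of j] AE_space
    proof eventually_elim
      case (elim x)
      then show ?case
        using density_pos[OF \<theta> elim(2)]
        by (simp add: lifted_error_def sqrt_embedding_def)
    qed
  qed measurable
  ultimately show ?thesis by (simp split: if_splits)
qed

lemma covariance_matrix_eq_inner:
  assumes T: "unbiased_estimator \<mu> \<Theta> P T" and \<theta>: "\<theta> \<in> \<Theta>"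
  shows "covariance_matrix P T \<theta> $ p $ q
    = L2_inner \<mu> (lifted_error f T \<theta> p) (lifted_error f T \<theta> q)"
proof -
  note [measurable] = estimator_error_measurable[OF T \<theta>]
  have "(\<integral>x. (T x $ p - \<theta> $ p) * (T x $ q - \<theta> $ q) \<partial>P \<theta>)
      = (\<integral>x. (T x $ p - \<theta> $ p) * (T x $ q - \<theta> $ q) * f x \<theta> \<partial>\<mu>)"
    by (rule integral_model[OF \<theta>]) measurable
  also have "\<dots> = L2_inner \<mu> (lifted_error f T \<theta> p) (lifted_error f T \<theta> q)"
    unfolding L2_inner_def
  proof (rule Bochner_Integration.integral_cong[OF refl])
    fix x assume "x \<in> space \<mu>"
    then have "sqrt (f x \<theta>) * sqrt (f x \<theta>) = f x \<theta>"
      using density_pos[OF \<theta>] by (simp add: less_imp_le)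
    then show "(T x $ p - \<theta> $ p) * (T x $ q - \<theta> $ q) * f x \<theta>
        = lifted_error f T \<theta> p x * lifted_error f T \<theta> q x"
      unfolding lifted_error_def sqrt_embedding_def by (metis mult.assoc mult.left_commute)
  qed
  finally show ?thesis by (simp add: covariance_matrix_def)
qed

end

theorem theorem6:
  fixes \<mu> :: "'a measure"
    and \<Theta> :: "(real^('d::{finite,linorder})) set"
    and P :: "real^('d::{finite,linorder}) \<Rightarrow> 'a measure"
    and f :: "'a \<Rightarrow> real^('d::{finite,linorder}) \<Rightarrow> real"
    and T :: "'a \<Rightarrow> real^('d::{finite,linorder})"
    and \<theta> v :: "real^('d::{finite,linorder})"
  assumes "sigma_finite_measure \<mu>"
    and "open \<Theta>"
    and "\<theta> \<in> \<Theta>"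
    and "density_family \<mu> \<Theta> P f"
    and "regular_order \<mu> \<Theta> P f 2 \<theta>"
    and "unbiased_estimator \<mu> \<Theta> P T"
  shows "v \<bullet> ((covariance_matrix P T \<theta> - matrix_inv (fisher_information P f \<theta>)) *v v)
           = (L2_norm \<mu> (\<lambda>x. error_dir f T \<theta> v x
                - L2_proj \<mu> (tangent_space \<mu> f \<theta>) (error_dir f T \<theta> v) x))\<^sup>2
       \<and> (L2_norm \<mu> (\<lambda>x. error_dir f T \<theta> v x
                - L2_proj \<mu> (tangent_space \<mu> f \<theta>) (error_dir f T \<theta> v) x))\<^sup>2
           \<ge> (if AE x in \<mu>. second_form_dir \<mu> f \<theta> v x = 0 then 0
              else (L2_inner \<mu> (error_dir f T \<theta> v) (second_form_dir \<mu> f \<theta> v))\<^sup>2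
                     / (L2_norm \<mu> (second_form_dir \<mu> f \<theta> v))\<^sup>2)
       \<and> v \<bullet> ((covariance_matrix P T \<theta> - matrix_inv (fisher_information P f \<theta>)) *v v)
           \<ge> (if AE x in \<mu>. (\<Sum>i\<in>UNIV. \<Sum>j\<in>UNIV. raised \<mu> f \<theta> v $ i * raised \<mu> f \<theta> v $ j
                                 * second_fundamental_form \<mu> f i j \<theta> x) = 0 then 0
              else (\<Sum>p\<in>UNIV. \<Sum>i\<in>UNIV. \<Sum>j\<in>UNIV.
                      v $ p * raised \<mu> f \<theta> v $ i * raised \<mu> f \<theta> v $ j
                      * L2_inner \<mu> (lifted_error f T \<theta> p) (second_fundamental_form \<mu> f i j \<theta>))\<^sup>2
                   / (L2_norm \<mu> (\<lambda>x. \<Sum>i\<in>UNIV. \<Sum>j\<in>UNIV.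
                        raised \<mu> f \<theta> v $ i * raised \<mu> f \<theta> v $ j
                        * second_fundamental_form \<mu> f i j \<theta> x))\<^sup>2)"
proof -
  define G where "G = gram_matrix \<mu> f \<theta>"
  define \<eta> where "\<eta> i = tangent_vec \<mu> f i \<theta>" for i
  define V where "V = tangent_space \<mu> f \<theta>"
  define Z where "Z = error_dir f T \<theta> v"
  define R where "R = (\<lambda>x. Z x - L2_proj \<mu> V Z x)"
  define W where "W = second_form_dir \<mu> f \<theta> v"
  define K where "K i j = second_fundamental_form \<mu> f i j \<theta>" for i j
  define r where "r = raised \<mu> f \<theta> v"
  \<comment> \<open>\<open>one_le_numeral\<close> supplies \<open>1 \<le> m\<close> for the order
    \<open>m = 2\<close>.\<close>
  note model = assms(2,4,5) one_le_numeral

  \<comment> \<open>Projection onto the tangent space\<close>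
  have \<eta>: "\<eta> i \<in> L2_space \<mu>" for i
    unfolding \<eta>_def by (rule tangent_vec_L2[OF model assms(3)])
  have G_eq: "G = (\<chi> i j. L2_inner \<mu> (\<eta> i) (\<eta> j))"
    by (simp add: G_def gram_matrix_def \<eta>_def)
  have V_eq: "V = {\<lambda>x. \<Sum>i\<in>UNIV. c i * \<eta> i x | c. True}"
    by (simp add: V_def tangent_space_def \<eta>_def)
  have G: "invertible G"
    unfolding G_def by (rule invertible_gram_matrix[OF model])
  note proj_L2 = L2_proj_span_L2[of \<eta> \<mu>, folded G_eq V_eq, OF \<eta> G]
    and proj_mem = L2_proj_span_mem[of \<eta> \<mu>, folded G_eq V_eq, OF \<eta> G]
    and proj_orthogonal = L2_proj_span_orthogonal[of \<eta> \<mu>, folded G_eq V_eq, OF \<eta> G]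
    and residual = L2_proj_span_residual[of \<eta> \<mu>, folded G_eq V_eq, OF \<eta> G]

  \<comment> \<open>The lifted error in direction \<open>v\<close>\<close>
  have le: "lifted_error f T \<theta> p \<in> L2_space \<mu>" for p
    by (rule lifted_error_L2[OF model assms(6,3)])
  have Z_eq: "Z = (\<lambda>x. \<Sum>p\<in>UNIV. v $ p * lifted_error f T \<theta> p x)"
    by (simp add: Z_def error_dir_def)
  have Z: "Z \<in> L2_space \<mu>"
    unfolding Z_eq by (intro L2_space_sum L2_space_cmult le)
  have Z_left: "L2_inner \<mu> Z w = (\<Sum>p\<in>UNIV. v $ p * L2_inner \<mu> (lifted_error f T \<theta> p) w)"
    if "w \<in> L2_space \<mu>" for w
    unfolding Z_eq using that
    by (simp add: L2_inner_sum_left L2_space_cmult le L2_inner_cmult_left)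
  have "L2_inner \<mu> Z (\<eta> i) = v $ i / 2" for i
  proof -
    have "L2_inner \<mu> Z (\<eta> i) = (\<Sum>p\<in>UNIV. v $ p * (if p = i then 1 / 2 else 0))"
      unfolding Z_left[OF \<eta>]
      by (simp only: \<eta>_def lifted_error_inner_tangent_vec[OF model assms(6,3)])
    also have "\<dots> = v $ i / 2" by (simp add: if_distrib[of "\<lambda>a. _ * a"] cong: if_cong)
    finally show ?thesis .
  qed
  \<comment> \<open>These inner products do not depend on which unbiased estimator is used, so the
    projected part of \<open>Z\<close> is determined by the model and \<open>v\<close>.\<close>
  then have Z_\<eta>: "(\<chi> i. L2_inner \<mu> Z (\<eta> i)) = (1 / 2) *\<^sub>R v"
    by (simp add: vec_eq_iff)
  have le_Z: "L2_inner \<mu> (lifted_error f T \<theta> p) Z = (covariance_matrix P T \<theta> *v v) $ p" for p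
    unfolding Z_eq
    by (simp add: L2_inner_sum_right L2_space_cmult le L2_inner_cmult_right
        matrix_vector_mult_def covariance_matrix_eq_inner[OF model assms(6,3)] mult.commute)
  have "L2_inner \<mu> Z Z = v \<bullet> (covariance_matrix P T \<theta> *v v)"
    by (simp add: Z_left[OF Z] le_Z inner_vec_def)
  then have ZZ: "v \<bullet> (covariance_matrix P T \<theta> *v v) = L2_inner \<mu> Z Z" ..

  \<comment> \<open>The excess covariance as a squared residual\<close>
  have "matrix_inv (fisher_information P f \<theta>) = (1 / 4) *\<^sub>R matrix_inv G"
    unfolding fisher_information_eq_gram_matrix[OF model assms(3)] G_def[symmetric]
    using G by (rule matrix_inv_cmult) simp
  then have "v \<bullet> ((covariance_matrix P T \<theta> - matrix_inv (fisher_information P f \<theta>)) *v v)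
      = L2_inner \<mu> Z Z - (1 / 4) * (v \<bullet> (matrix_inv G *v v))"
    by (simp add: matrix_vector_mult_diff_rdistrib inner_diff_right ZZ
        scaleR_matrix_vector_assoc[symmetric])
  \<comment> \<open>The two factors \<open>1 / 2\<close> from \<open>Z_\<eta>\<close> produce the
    same \<open>1 / 4\<close> as inverting \<open>J = 4 G\<close>.\<close>
  also have "\<dots> = (L2_norm \<mu> R)\<^sup>2"
    unfolding R_def residual[OF Z] Z_\<eta> by (simp add: matrix_vector_mult_scaleR)
  finally have eq: "v \<bullet> ((covariance_matrix P T \<theta> - matrix_inv (fisher_information P f \<theta>)) *v v)
      = (L2_norm \<mu> R)\<^sup>2" .

  \<comment> \<open>The second fundamental form and the lower bound\<close>
  have D2: "L2_partial \<mu> i (tangent_vec \<mu> f j) \<theta> \<in> L2_space \<mu>" for i j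
    by (rule second_partial_L2[OF model assms(3)]) simp
  have K: "K i j \<in> L2_space \<mu>" for i j
    unfolding K_def second_fundamental_form_def V_def[symmetric]
    by (intro L2_space_diff D2 proj_L2)
  have W_eq: "W = (\<lambda>x. \<Sum>i\<in>UNIV. \<Sum>j\<in>UNIV. r $ i * r $ j * K i j x)"
    by (simp add: W_def second_form_dir_def r_def K_def)
  have W: "W \<in> L2_space \<mu>"
    unfolding W_eq by (intro L2_space_sum L2_space_cmult K)
  have W_right: "L2_inner \<mu> w W = (\<Sum>i\<in>UNIV. \<Sum>j\<in>UNIV. r $ i * r $ j * L2_inner \<mu> w (K i j))"
    if "w \<in> L2_space \<mu>" for w
    unfolding W_eq using that
    by (simp add: L2_inner_sum_right L2_space_sum L2_space_cmult K L2_inner_cmult_right)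
  have pZ: "L2_proj \<mu> V Z \<in> L2_space \<mu>" by (rule proj_L2[OF Z])
  \<comment> \<open>\<open>K i j\<close> is the residual of a projection onto \<open>V\<close>,
    whereas the projection of \<open>Z\<close> lies in \<open>V\<close>.\<close>
  have "L2_inner \<mu> (L2_proj \<mu> V Z) (K i j) = 0" for i j
    unfolding L2_inner_commute[of \<mu> "L2_proj \<mu> V Z"] K_def second_fundamental_form_def V_def[symmetric]
    by (intro proj_orthogonal D2 proj_mem Z)
  then have "L2_inner \<mu> (L2_proj \<mu> V Z) W = 0"
    by (simp add: W_right[OF pZ])
  then have ZW: "L2_inner \<mu> Z W = L2_inner \<mu> R W"
    unfolding R_def by (simp add: L2_inner_diff_left[OF Z pZ W])
  have R: "R \<in> L2_space \<mu>" unfolding R_def by (rule L2_space_diff[OF Z pZ])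
  \<comment> \<open>Cauchy-Schwarz is applied to the residual \<open>R\<close>, not to
    \<open>Z\<close>; with \<open>Z\<close> it would bound only the full variance.\<close>
  have bound: "(L2_inner \<mu> Z W)\<^sup>2 / (L2_norm \<mu> W)\<^sup>2 \<le> (L2_norm \<mu> R)\<^sup>2"
    unfolding ZW by (rule L2_Cauchy_Schwarz_quotient[OF R W])
  have ZW_comp: "L2_inner \<mu> Z W = (\<Sum>p\<in>UNIV. \<Sum>i\<in>UNIV. \<Sum>j\<in>UNIV.
      v $ p * r $ i * r $ j * L2_inner \<mu> (lifted_error f T \<theta> p) (K i j))"
    unfolding Z_left[OF W] W_right[OF le] by (simp add: sum_distrib_left mult.assoc)
  \<comment> \<open>Once the abbreviations are folded, both inequalities have the same right-hand
    side. If \<open>W\<close> vanishes almost everywhere it is \<open>0\<close>, below any square;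
    otherwise it is covered by \<open>bound\<close>.\<close>
  show ?thesis
    unfolding Z_def[symmetric] V_def[symmetric] R_def[symmetric] W_def[symmetric] eq
      r_def[symmetric] K_def[symmetric] W_eq[symmetric] ZW_comp[symmetric]
    using bound by simp
qed

end
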